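(* Let $n\ge 3$, $0\le p\le [n/2]$, and let $S$ be a non-planar (i.e. not contained in an affine plane) ruled minimal surface of the pseudo-Euclidean space $\mathbb{R}^n_p$ in generic situations. Then $S$ is locally homothetic to an open subset of one of the following surfaces: 1. (minimal cylinder) $f(s,t)=\gamma_0 t+x(s)$, where $\gamma_0$ is a null vector and $x(s)$ is a null curve such that $\langle\gamma_0,x'(s)\rangle_p\neq 0$; 2. (elliptic helicoid of the first kind) $f(s,t)=(\cos s\,e_1+\sin s\,e_2)t+s e_3$, where $\{e_1,e_2,e_3\}$ is an orthonormal system, $\langle e_1,e_1\rangle_p=\langle e_2,e_2\rangle_p=\pm1$, $\langle e_3,e_3\rangle_p=\pm1$; 3. (elliptic helicoid of the second kind) $f(s,t)=(\cos s\,e_1+\sin s\,e_2)t+s e_3$, where $\{e_1,e_2,e_3\}$ is an orthogonal system, $\langle e_1,e_1\rangle_p=\langle e_2,e_2\rangle_p=\pm1$, $\langle e_3,e_3\rangle_p=0$; 4. (hyperbolic helicoid of the first kind) $f(s,t)=(\cosh s\,e_1+\sinh s\,e_2)t+s e_3$, where $\{e_1,e_2,e_3\}$ is an orthonormal system, $\langle e_1,e_1\rangle_p=-\langle e_2,e_2\rangle_p=\pm1$, $\langle e_3,e_3\rangle_p=\pm1$; 5. (hyperbolic helicoid of the second kind) $f(s,t)=(\cosh s\,e_1+\sinh s\,e_2)t+s e_3$, where $\{e_1,e_2,e_3\}$ is an orthogonal system, $\langle e_1,e_1\rangle_p=-\langle e_2,e_2\rangle_p=\pm1$, $\langle e_3,e_3\rangle_p=0$;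 6. (parabolic helicoid) $f(s,t)=(t+s^2)e_1+\left(\frac{s^3}{3}+st-s\right)e_2+\left(\frac{s^3}{3}+st+s\right)e_3$, where $\{e_1,e_2,e_3\}$ is an orthonormal system, $\langle e_1,e_1\rangle_p=\langle e_2,e_2\rangle_p=-\langle e_3,e_3\rangle_p=\pm1$; 7. (minimal hyperbolic paraboloid) $f(s,t)=st\,e_1+t e_2+s e_3$, where $\{e_1,e_2,e_3\}$ is an orthogonal system, $\langle e_1,e_1\rangle_p=0$, $\langle e_2,e_2\rangle_p=\pm1$, $\langle e_3,e_3\rangle_p=\pm1$. In each item the double signs $\pm$ of separate equations are arbitrary (independent of each other).
   Context: $\mathbb{R}^n_p$ denotes $\mathbb{R}^n$ with the metric $\langle\cdot,\cdot\rangle_p=-\sum_{i=1}^p dx_i^2+\sum_{j=p+1}^n dx_j^2$, where $n\ge3$ and $0\le p\le[n/2]$. A non-zero vector $v$ is null (lightlike) if $\langle v,v\rangle_p=0$. A $C^\infty$-regular curve $c$ is a null curve if $\langle c'(s),c'(s)\rangle_p=0$ for all $s$. Ruled surface: let $I\subset\mathbb{R}$ be an open interval containing $0$, $\gamma:I\to\mathbb{R}^n\setminus\{0\}$ a $C^\infty$ curve (direction curve) and $x:I\to\mathbb{R}^n$ a $C^\infty$-regular curve (base curve), such that $f:I\times\mathbb{R}\to\mathbb{R}^n$, $f(s,t)=\gamma(s)t+x(s)$, is an immersion. The image $S$ of $f$ is called a ruled surface. Minimal: with respect to coordinates $(u_1,u_2)=(s,t)$ let $g_{ij}$ be the coefficients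 of the induced metric $g$ and $h_{ij}$ those of the (normal-vector-valued) second fundamental form $h$. $S$ is minimal if $g$ is non-degenerate, i.e. $\det g=g_{11}g_{22}-g_{12}^2\ne0$, and the mean curvature vector field $\vec H=\frac12\,\frac{g_{11}h_{22}-2g_{12}h_{12}+g_{22}h_{11}}{\det g}$ vanishes identically. Generic situations: a ruled surface is singular at $s_0\in I$ if (i) at least one of the functions $\langle\gamma,\gamma\rangle_p$, $\langle\gamma',\gamma'\rangle_p$, $\langle x',x'\rangle_p$, $\langle\gamma',x'\rangle_p$ is zero at $s_0$ and is not identically zero on any neighborhood of $s_0$; or (ii) $\gamma',x'$ are linearly dependent at $s_0$, and every neighborhood of $s_0$ contains a point at which they are linearly independent. A ruled surface is in generic situations if it is not singular at any $s\in I$. An orthogonal system is a set of non-zero, mutually orthogonal vectors with respect to $\langle\cdot,\cdot\rangle_p$; it is an orthonormal system if moreover each vector $e$ satisfies $\langle e,e\rangle_p=\pm1$. "Locally homothetic" means: each point of $S$ has a neighborhood in $S$ which is mapped onto an open subset of the model surface by a map $y\mapsto cAy+b$ of $\mathbb{R}^n_p$ with $c>0$, $A$ a linear isometry of $\mathbb{R}^n_p$ and $b\in\mathbb{R}^n$. *)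

theory Defs
  imports "HOL-Analysis.Analysis"
begin

text \<open>
  A plain synonym for \<open>real ^ 'n\<close>, whose syntax would force the sort \<open>finite\<close> onto \<open>'n\<close>.
\<close>

type_synonym 'n coords = "(real, 'n) vec"

text \<open>
  The index type is linearly ordered, so that ``the first \<open>p\<close> coordinates'' makes sense:
  a coordinate is among them iff it has fewer than \<open>p\<close> predecessors.
\<close>

definition pscal :: "nat \<Rightarrow> 'n::{finite,linorder} coords \<Rightarrow> 'n coords \<Rightarrow> real" where
  "pscal p u v =
     - (\<Sum>i \<in> {i. card {j. j < i} < p}. u $ i * v $ i)
     + (\<Sum>i \<in> {i. p \<le> card {j. j < i}}. u $ i * v $ i)"

definition null_vector :: "nat \<Rightarrow> 'n::{finite,linorder} coords \<Rightarrow> bool" where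
  "null_vector p v \<longleftrightarrow> v \<noteq> 0 \<and> pscal p v v = 0"

text \<open>
  Systems are lists, so that the members of \<open>[e1, e2, e3]\<close> are really three different vectors;
  with the set \<open>{e1, e2, e3}\<close> the case \<open>e1 = e2\<close> would slip through.
\<close>

definition orthogonal_system :: "nat \<Rightarrow> ('n::{finite,linorder} coords) list \<Rightarrow> bool" where
  "orthogonal_system p es \<longleftrightarrow>
     distinct es \<and> (\<forall>e \<in> set es. e \<noteq> 0) \<and> sorted_wrt (\<lambda>u v. pscal p u v = 0) es"

definition orthonormal_system :: "nat \<Rightarrow> ('n::{finite,linorder} coords) list \<Rightarrow> bool" where
  "orthonormal_system p es \<longleftrightarrow>
     orthogonal_system p es \<and> (\<forall>e \<in> set es. pscal p e e \<in> {1, -1})"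

definition linear_isometry :: "nat \<Rightarrow> ('n::{finite,linorder} coords \<Rightarrow> 'n coords) \<Rightarrow> bool" where
  "linear_isometry p A \<longleftrightarrow> linear A \<and> (\<forall>u v. pscal p (A u) (A v) = pscal p u v)"


subsection \<open>Curves\<close>

definition curve_deriv :: "(real \<Rightarrow> 'v::real_normed_vector) \<Rightarrow> real \<Rightarrow> 'v" where
  "curve_deriv c s = vector_derivative c (at s)"

text \<open>The set \<open>I\<close> is meant to be open; values of \<open>c\<close> outside are irrelevant.\<close>

definition smooth_curve :: "real set \<Rightarrow> (real \<Rightarrow> 'v::real_normed_vector) \<Rightarrow> bool" where
  "smooth_curve I c \<longleftrightarrow> (\<forall>k. \<forall>s\<in>I. (curve_deriv ^^ k) c differentiable (at s))"

definition regular_curve :: "real set \<Rightarrow> (real \<Rightarrow> 'v::real_normed_vector) \<Rightarrow> bool" where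
  "regular_curve I c \<longleftrightarrow> smooth_curve I c \<and> (\<forall>s\<in>I. curve_deriv c s \<noteq> 0)"

definition null_curve :: "nat \<Rightarrow> real set \<Rightarrow> (real \<Rightarrow> 'n::{finite,linorder} coords) \<Rightarrow> bool" where
  "null_curve p I c \<longleftrightarrow>
     regular_curve I c \<and> (\<forall>s\<in>I. pscal p (curve_deriv c s) (curve_deriv c s) = 0)"


subsection \<open>Parametrized surfaces\<close>

definition immersion_on :: "(real \<times> real) set \<Rightarrow> (real \<times> real \<Rightarrow> 'v::real_normed_vector) \<Rightarrow> bool" where
  "immersion_on U f \<longleftrightarrow> (\<forall>z\<in>U. f differentiable (at z) \<and> inj (frechet_derivative f (at z)))"

abbreviation dir1 :: "real \<times> real" where "dir1 \<equiv> (1, 0)"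
abbreviation dir2 :: "real \<times> real" where "dir2 \<equiv> (0, 1)"

definition partial ::
    "real \<times> real \<Rightarrow> (real \<times> real \<Rightarrow> 'v::real_normed_vector) \<Rightarrow> real \<times> real \<Rightarrow> 'v" where
  "partial d f z = frechet_derivative f (at z) d"

definition tangent_space :: "(real \<times> real \<Rightarrow> 'v::real_normed_vector) \<Rightarrow> real \<times> real \<Rightarrow> 'v set" where
  "tangent_space f z = span {partial dir1 f z, partial dir2 f z}"

text \<open>
  The component of \<open>v\<close> in the normal space of \<open>T\<close>; it exists and is unique when the
  scalar product is non-degenerate on \<open>T\<close>.
\<close>

definition normal_part ::
    "nat \<Rightarrow> ('n::{finite,linorder} coords) set \<Rightarrow> 'n coords \<Rightarrow> 'n coords" where
  "normal_part p T v = (THE w. (\<forall>u\<in>T. pscal p w u = 0) \<and> v - w \<in> T)"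

definition metric_coeff ::
    "nat \<Rightarrow> (real \<times> real \<Rightarrow> 'n::{finite,linorder} coords) \<Rightarrow> real \<times> real \<Rightarrow> real \<times> real
      \<Rightarrow> real \<times> real \<Rightarrow> real" where
  "metric_coeff p f d e z = pscal p (partial d f z) (partial e f z)"

definition second_form_coeff ::
    "nat \<Rightarrow> (real \<times> real \<Rightarrow> 'n::{finite,linorder} coords) \<Rightarrow> real \<times> real \<Rightarrow> real \<times> real
      \<Rightarrow> real \<times> real \<Rightarrow> 'n coords" where
  "second_form_coeff p f d e z =
     normal_part p (tangent_space f z) (partial e (partial d f) z)"

definition metric_det ::
    "nat \<Rightarrow> (real \<times> real \<Rightarrow> 'n::{finite,linorder} coords) \<Rightarrow> real \<times> real \<Rightarrow> real" where
  "metric_det p f z =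
     metric_coeff p f dir1 dir1 z * metric_coeff p f dir2 dir2 z - (metric_coeff p f dir1 dir2 z)\<^sup>2"

definition mean_curvature ::
    "nat \<Rightarrow> (real \<times> real \<Rightarrow> 'n::{finite,linorder} coords) \<Rightarrow> real \<times> real \<Rightarrow> 'n coords" where
  "mean_curvature p f z =
     (1 / 2) *\<^sub>R ((1 / metric_det p f z) *\<^sub>R
       (metric_coeff p f dir1 dir1 z *\<^sub>R second_form_coeff p f dir2 dir2 z
        - (2 * metric_coeff p f dir1 dir2 z) *\<^sub>R second_form_coeff p f dir1 dir2 z
        + metric_coeff p f dir2 dir2 z *\<^sub>R second_form_coeff p f dir1 dir1 z))"

definition minimal_on ::
    "nat \<Rightarrow> (real \<times> real) set \<Rightarrow> (real \<times> real \<Rightarrow> 'n::{finite,linorder} coords) \<Rightarrow> bool" where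
  "minimal_on p U f \<longleftrightarrow> (\<forall>z\<in>U. metric_det p f z \<noteq> 0 \<and> mean_curvature p f z = 0)"


subsection \<open>Ruled surfaces\<close>

definition ruled_map ::
    "(real \<Rightarrow> 'v::real_normed_vector) \<Rightarrow> (real \<Rightarrow> 'v) \<Rightarrow> real \<times> real \<Rightarrow> 'v" where
  "ruled_map \<gamma> x = (\<lambda>(s, t). t *\<^sub>R \<gamma> s + x s)"

definition open_interval :: "real set \<Rightarrow> bool" where
  "open_interval I \<longleftrightarrow> I \<noteq> {} \<and> open I \<and> is_interval I"

definition ruled_surface ::
    "real set \<Rightarrow> (real \<Rightarrow> 'v::real_normed_vector) \<Rightarrow> (real \<Rightarrow> 'v) \<Rightarrow> bool" where
  "ruled_surface I \<gamma> x \<longleftrightarrow>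
     open_interval I \<and> 0 \<in> I
     \<and> smooth_curve I \<gamma> \<and> (\<forall>s\<in>I. \<gamma> s \<noteq> 0)
     \<and> regular_curve I x
     \<and> immersion_on (I \<times> UNIV) (ruled_map \<gamma> x)"

definition lin_dependent :: "'v::real_vector \<Rightarrow> 'v \<Rightarrow> bool" where
  "lin_dependent v w \<longleftrightarrow> (\<exists>a b. (a, b) \<noteq> (0, 0) \<and> a *\<^sub>R v + b *\<^sub>R w = 0)"

definition singular_at ::
    "nat \<Rightarrow> (real \<Rightarrow> 'n::{finite,linorder} coords) \<Rightarrow> (real \<Rightarrow> 'n coords) \<Rightarrow> real \<Rightarrow> bool" where
  "singular_at p \<gamma> x s0 \<longleftrightarrow>
     (\<exists>\<phi> \<in> {\<lambda>s. pscal p (\<gamma> s) (\<gamma> s),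
             \<lambda>s. pscal p (curve_deriv \<gamma> s) (curve_deriv \<gamma> s),
             \<lambda>s. pscal p (curve_deriv x s) (curve_deriv x s),
             \<lambda>s. pscal p (curve_deriv \<gamma> s) (curve_deriv x s)}.
        \<phi> s0 = 0 \<and> frequently (\<lambda>s. \<phi> s \<noteq> 0) (nhds s0))
     \<or> (lin_dependent (curve_deriv \<gamma> s0) (curve_deriv x s0)
        \<and> frequently (\<lambda>s. \<not> lin_dependent (curve_deriv \<gamma> s) (curve_deriv x s)) (nhds s0))"

definition generic_situations ::
    "nat \<Rightarrow> real set \<Rightarrow> (real \<Rightarrow> 'n::{finite,linorder} coords) \<Rightarrow> (real \<Rightarrow> 'n coords) \<Rightarrow> bool" where
  "generic_situations p I \<gamma> x \<longleftrightarrow> (\<forall>s\<in>I. \<not> singular_at p \<gamma> x s)"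

definition planar :: "('n::finite coords) set \<Rightarrow> bool" where
  "planar S \<longleftrightarrow> (\<exists>P. affine P \<and> aff_dim P = 2 \<and> S \<subseteq> P)"

definition locally_homothetic ::
    "nat \<Rightarrow> ('n::{finite,linorder} coords) set \<Rightarrow> ('n coords) set \<Rightarrow> bool" where
  "locally_homothetic p S M \<longleftrightarrow>
     (\<forall>y\<in>S. \<exists>U. openin (top_of_set S) U \<and> y \<in> U \<and>
        (\<exists>c A b. c > 0 \<and> linear_isometry p A \<and>
           openin (top_of_set M) ((\<lambda>v. c *\<^sub>R A v + b) ` U)))"


subsection \<open>The model surfaces\<close>

definition minimal_cylinder :: "nat \<Rightarrow> ('n::{finite,linorder} coords) set \<Rightarrow> bool" where
  "minimal_cylinder p M \<longleftrightarrow>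
     (\<exists>J \<gamma>0 x. open_interval J \<and> null_vector p \<gamma>0 \<and> null_curve p J x
        \<and> (\<forall>s\<in>J. pscal p \<gamma>0 (curve_deriv x s) \<noteq> 0)
        \<and> M = (\<lambda>(s, t). t *\<^sub>R \<gamma>0 + x s) ` (J \<times> UNIV))"

definition elliptic_helicoid_first :: "nat \<Rightarrow> ('n::{finite,linorder} coords) set \<Rightarrow> bool" where
  "elliptic_helicoid_first p M \<longleftrightarrow>
     (\<exists>e1 e2 e3. orthonormal_system p [e1, e2, e3]
        \<and> pscal p e1 e1 = pscal p e2 e2 \<and> pscal p e1 e1 \<in> {1, -1} \<and> pscal p e3 e3 \<in> {1, -1}
        \<and> M = range (\<lambda>(s, t). t *\<^sub>R (cos s *\<^sub>R e1 + sin s *\<^sub>R e2) + s *\<^sub>R e3))"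

definition elliptic_helicoid_second :: "nat \<Rightarrow> ('n::{finite,linorder} coords) set \<Rightarrow> bool" where
  "elliptic_helicoid_second p M \<longleftrightarrow>
     (\<exists>e1 e2 e3. orthogonal_system p [e1, e2, e3]
        \<and> pscal p e1 e1 = pscal p e2 e2 \<and> pscal p e1 e1 \<in> {1, -1} \<and> pscal p e3 e3 = 0
        \<and> M = range (\<lambda>(s, t). t *\<^sub>R (cos s *\<^sub>R e1 + sin s *\<^sub>R e2) + s *\<^sub>R e3))"

definition hyperbolic_helicoid_first :: "nat \<Rightarrow> ('n::{finite,linorder} coords) set \<Rightarrow> bool" where
  "hyperbolic_helicoid_first p M \<longleftrightarrow>
     (\<exists>e1 e2 e3. orthonormal_system p [e1, e2, e3]
        \<and> pscal p e1 e1 = - pscal p e2 e2 \<and> pscal p e1 e1 \<in> {1, -1} \<and> pscal p e3 e3 \<in> {1, -1}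
        \<and> M = range (\<lambda>(s, t). t *\<^sub>R (cosh s *\<^sub>R e1 + sinh s *\<^sub>R e2) + s *\<^sub>R e3))"

definition hyperbolic_helicoid_second :: "nat \<Rightarrow> ('n::{finite,linorder} coords) set \<Rightarrow> bool" where
  "hyperbolic_helicoid_second p M \<longleftrightarrow>
     (\<exists>e1 e2 e3. orthogonal_system p [e1, e2, e3]
        \<and> pscal p e1 e1 = - pscal p e2 e2 \<and> pscal p e1 e1 \<in> {1, -1} \<and> pscal p e3 e3 = 0
        \<and> M = range (\<lambda>(s, t). t *\<^sub>R (cosh s *\<^sub>R e1 + sinh s *\<^sub>R e2) + s *\<^sub>R e3))"

definition parabolic_helicoid :: "nat \<Rightarrow> ('n::{finite,linorder} coords) set \<Rightarrow> bool" where
  "parabolic_helicoid p M \<longleftrightarrow>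
     (\<exists>e1 e2 e3. orthonormal_system p [e1, e2, e3]
        \<and> pscal p e1 e1 = pscal p e2 e2 \<and> pscal p e2 e2 = - pscal p e3 e3
        \<and> pscal p e1 e1 \<in> {1, -1}
        \<and> M = range (\<lambda>(s, t). (t + s\<^sup>2) *\<^sub>R e1 + (s ^ 3 / 3 + s * t - s) *\<^sub>R e2
                                + (s ^ 3 / 3 + s * t + s) *\<^sub>R e3))"

definition minimal_hyperbolic_paraboloid :: "nat \<Rightarrow> ('n::{finite,linorder} coords) set \<Rightarrow> bool" where
  "minimal_hyperbolic_paraboloid p M \<longleftrightarrow>
     (\<exists>e1 e2 e3. orthogonal_system p [e1, e2, e3]
        \<and> pscal p e1 e1 = 0 \<and> pscal p e2 e2 \<in> {1, -1} \<and> pscal p e3 e3 \<in> {1, -1}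
        \<and> M = range (\<lambda>(s, t). (s * t) *\<^sub>R e1 + t *\<^sub>R e2 + s *\<^sub>R e3))"

end

theory Submission
  imports Defs
begin

text \<open>
  For a ruled surface \<open>f(s, t) = t \<gamma>(s) + x(s)\<close> the second derivative \<open>f\<^sub>t\<^sub>t\<close> vanishes, and minimality
  says that \<open>\<langle>\<gamma>, \<gamma>\<rangle> f\<^sub>s\<^sub>s - 2 \<langle>f\<^sub>s, \<gamma>\<rangle> \<gamma>'\<close> is tangent at every point
  (\<open>minimal_ruled_surface_equation\<close>). By non-singularity \<open>\<langle>\<gamma>, \<gamma>\<rangle>\<close> is either identically or nowhere zero.

  If it is identically zero, the equation forces \<open>\<gamma>'\<close> to be a multiple of \<open>\<gamma>\<close>. The rulings are then
  parallel to a null vector, the base curve can be slid along them until it is null, and the surface is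
  a minimal cylinder (\<open>null_ruling_minimal_cylinder\<close>).

  If it is nowhere zero, one may take \<open>\<langle>\<gamma>, \<gamma>\<rangle> = \<epsilon> = \<plusminus>1\<close> and \<open>\<langle>\<gamma>, x'\<rangle> = 0\<close>
  (\<open>unit_orthogonal_parametrization\<close>). Now \<open>\<langle>t \<gamma>' + x', t \<gamma>' + x'\<rangle>\<close> has no zero, and comparing
  the minimal surface equation for several \<open>t\<close> on one ruling gives, with respect to the arc length of
  \<open>x\<close>, the linear equations \<open>\<gamma>'' = - \<epsilon> k \<gamma>\<close> and \<open>x'' = - \<epsilon> m \<gamma>\<close>, in which \<open>k = \<langle>\<gamma>', \<gamma>'\<rangle>\<close> and
  \<open>m = \<langle>\<gamma>', x'\<rangle>\<close> turn out to be constant (\<open>constant_coefficients\<close>). For \<open>k \<noteq> 0\<close> the direction \<open>\<gamma>\<close>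
  rotates in a plane, elliptically or hyperbolically according to the sign of \<open>\<epsilon> k\<close>, and the base curve
  can be slid onto a line orthogonal to that plane (\<open>rotating_ruling\<close>). This line is not null, since the
  metric is non-degenerate along all of each ruling, and the surface is a helicoid of the first kind.
  For \<open>k = 0\<close> also \<open>m = 0\<close>, all solutions are affine, and the surface is a minimal hyperbolic paraboloid
  unless it is planar (\<open>planar_or_hyperbolic_paraboloid\<close>).

  In every case the homothety is a dilation followed by a translation, and it maps the whole surface to an
  open part of the model at once.
\<close>

section \<open>The scalar product\<close>

lemma pscal_eq_sum:
  "pscal p u v = (\<Sum>i\<in>UNIV. (if card {j. j < i} < p then - 1 else 1) * (u $ i * v $ i))"
proof -
  have "(\<Sum>i\<in>UNIV. (if card {j. j < i} < p then - 1 else 1) * (u $ i * v $ i)) =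
    (\<Sum>i\<in>UNIV. if card {j. j < i} < p then - (u $ i * v $ i) else u $ i * v $ i)"
    by (intro sum.cong) auto
  also have "\<dots> = pscal p u v"
    unfolding pscal_def by (subst sum.If_cases) (auto simp: sum_negf not_less Collect_neg_eq[symmetric])
  finally show ?thesis by simp
qed

lemma pscal_commute: "pscal p u v = pscal p v u"
  by (simp add: pscal_def mult.commute)

interpretation pscal: bounded_bilinear "pscal p" for p
proof -
  have "bilinear (pscal p)"
    unfolding bilinear_def
    by (auto intro!: linearI simp: pscal_eq_sum algebra_simps sum.distrib sum_distrib_left)
  then show "bounded_bilinear (pscal p)"
    by (simp add: bilinear_conv_bounded_bilinear)
qed

lemmas pscal_expand = pscal.add_left pscal.add_right pscal.diff_left pscal.diff_right
  pscal.minus_left pscal.minus_right pscal.scaleR_left pscal.scaleR_right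
  pscal.zero_left pscal.zero_right

lemma mem_span_pair: "v \<in> span {a, b} \<longleftrightarrow> (\<exists>\<alpha> \<beta>. v = \<alpha> *\<^sub>R a + \<beta> *\<^sub>R b)"
proof
  assume "v \<in> span {a, b}"
  then obtain \<alpha> where "v - \<alpha> *\<^sub>R a \<in> span {b}" by (auto simp: span_breakdown_eq)
  then obtain \<beta> where "v - \<alpha> *\<^sub>R a = \<beta> *\<^sub>R b" by (auto simp: span_singleton)
  then show "\<exists>\<alpha> \<beta>. v = \<alpha> *\<^sub>R a + \<beta> *\<^sub>R b" by (metis add.commute diff_add_cancel)
next
  assume "\<exists>\<alpha> \<beta>. v = \<alpha> *\<^sub>R a + \<beta> *\<^sub>R b"
  then show "v \<in> span {a, b}" by (metis insertI1 insertI2 span_add span_base span_scale)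
qed

text \<open>
  The two orthogonality conditions are a linear system for the coordinates of \<open>d\<close> with respect to
  \<open>a, b\<close>, whose determinant is the Gram determinant.
\<close>

lemma nondegenerate_plane_orthogonal_zero:
  assumes det: "pscal p a a * pscal p b b - (pscal p a b)\<^sup>2 \<noteq> 0"
    and d: "d \<in> span {a, b}" "pscal p d a = 0" "pscal p d b = 0"
  shows "d = 0"
proof -
  obtain \<alpha> \<beta> where ab: "d = \<alpha> *\<^sub>R a + \<beta> *\<^sub>R b" using d(1) mem_span_pair by blast
  have e1: "\<alpha> * pscal p a a + \<beta> * pscal p a b = 0"
    using d(2) ab by (simp add: pscal_expand pscal_commute[of p b a])
  have e2: "\<alpha> * pscal p a b + \<beta> * pscal p b b = 0"
    using d(3) ab by (simp add: pscal_expand)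
  have "\<alpha> * (pscal p a a * pscal p b b - (pscal p a b)\<^sup>2) = 0"
    using e1 e2 by algebra
  moreover have "\<beta> * (pscal p a a * pscal p b b - (pscal p a b)\<^sup>2) = 0"
    using e1 e2 by algebra
  ultimately show ?thesis using det ab by simp
qed

text \<open>
  The normal part is given by a definite description, so existence and uniqueness have to be
  established: existence by Cramer's rule, uniqueness by non-degeneracy of the tangent plane. All that
  is used later is that taking the normal part changes a vector only by a tangent vector.
\<close>

lemma normal_part_difference_tangent:
  assumes det: "pscal p a a * pscal p b b - (pscal p a b)\<^sup>2 \<noteq> 0"
  shows "v - normal_part p (span {a, b}) v \<in> span {a, b}"
proof -
  let ?P = "\<lambda>w. (\<forall>u\<in>span {a, b}. pscal p w u = 0) \<and> v - w \<in> span {a, b}"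
  let ?D = "pscal p a a * pscal p b b - (pscal p a b)\<^sup>2"
  \<comment> \<open>Cramer's rule for the tangential component.\<close>
  define \<alpha> where "\<alpha> = (pscal p v a * pscal p b b - pscal p v b * pscal p a b) / ?D"
  define \<beta> where "\<beta> = (pscal p v b * pscal p a a - pscal p v a * pscal p a b) / ?D"
  define w where "w = v - (\<alpha> *\<^sub>R a + \<beta> *\<^sub>R b)"
  have "\<alpha> * ?D = pscal p v a * pscal p b b - pscal p v b * pscal p a b"
    and "\<beta> * ?D = pscal p v b * pscal p a a - pscal p v a * pscal p a b"
    using det by (simp_all add: \<alpha>_def \<beta>_def)
  then have "?D * (\<alpha> * pscal p a a + \<beta> * pscal p a b - pscal p v a) = 0"
    and "?D * (\<alpha> * pscal p a b + \<beta> * pscal p b b - pscal p v b) = 0"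
    by algebra+
  then have "pscal p w a = 0" "pscal p w b = 0"
    using det unfolding w_def by (simp_all add: pscal_expand pscal_commute[of p b a])
  then have "pscal p w u = 0" if "u \<in> span {a, b}" for u
    using that unfolding mem_span_pair by (auto simp: pscal_expand)
  moreover have "v - w \<in> span {a, b}"
    unfolding w_def mem_span_pair by auto
  ultimately have "?P w" by blast
  have "w' = w" if "?P w'" for w'
  proof -
    have "w' - w = (v - w) - (v - w')" by simp
    then have "w' - w \<in> span {a, b}" using \<open>?P w\<close> that by (metis span_diff)
    moreover have "pscal p (w' - w) u = 0" if "u \<in> {a, b}" for u
      using \<open>?P w\<close> \<open>?P w'\<close> span_base[OF that] by (simp add: pscal_expand)
    ultimately show ?thesis
      using nondegenerate_plane_orthogonal_zero[OF det, of "w' - w"] by simp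
  qed
  with \<open>?P w\<close> have "?P (normal_part p (span {a, b}) v)"
    unfolding normal_part_def by (rule theI)
  then show ?thesis by blast
qed

section \<open>Calculus of curves on an interval\<close>

text \<open>
  All differential equations below are solved by quadratures on the whole parameter interval, which
  may be unbounded and on which the integrand need not be integrable; hence the detour through an
  interval with extended real end points.
\<close>

lemma antiderivative_on_open_interval:
  fixes f :: "real \<Rightarrow> 'a::euclidean_space"
  assumes I: "open_interval I" and f: "continuous_on I f"
  obtains F where "\<And>s. s \<in> I \<Longrightarrow> (F has_vector_derivative f s) (at s)"
proof -
  define a b where "a = Inf (ereal ` I)" and "b = Sup (ereal ` I)"
  have I': "open I" "is_interval I" "I \<noteq> {}" using I by (auto simp: open_interval_def)
  have memI: "s \<in> I \<longleftrightarrow> a < ereal s \<and> ereal s < b" for s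
  proof
    assume s: "s \<in> I"
    then obtain e where e: "e > 0" "\<And>y. dist y s < e \<Longrightarrow> y \<in> I"
      using I'(1) unfolding open_dist by blast
    have "s - e / 2 \<in> I" "s + e / 2 \<in> I" using e by (auto simp: dist_real_def)
    then have "a \<le> ereal (s - e / 2)" "ereal (s + e / 2) \<le> b"
      unfolding a_def b_def by (auto intro: Inf_lower Sup_upper)
    moreover have "ereal (s - e / 2) < ereal s" "ereal s < ereal (s + e / 2)" using e by auto
    ultimately show "a < ereal s \<and> ereal s < b" by (meson le_less_trans less_le_trans)
  next
    assume "a < ereal s \<and> ereal s < b"
    then obtain u v where "u \<in> I" "v \<in> I" "u < s" "s < v"
      unfolding a_def b_def by (auto simp: Inf_less_iff less_Sup_iff)
    then show "s \<in> I" using I'(2) unfolding is_interval_1 by (meson less_imp_le)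
  qed
  have "a < b" using I'(3) memI by (meson all_not_in_conv less_trans)
  moreover have "isCont f s" if "a < ereal s" "ereal s < b" for s
    using that memI f I'(1) by (simp add: continuous_on_eq_continuous_at)
  ultimately obtain F where "\<forall>s. a < ereal s \<longrightarrow> ereal s < b \<longrightarrow> (F has_vector_derivative f s) (at s)"
    using einterval_antiderivative by blast
  then show ?thesis using that memI by blast
qed

lemma zero_derivative_constant:
  fixes f :: "real \<Rightarrow> 'a::real_normed_vector"
  assumes "open_interval I" "\<And>s. s \<in> I \<Longrightarrow> (f has_vector_derivative 0) (at s)"
  obtains c where "\<And>s. s \<in> I \<Longrightarrow> f s = c"
proof (rule has_vector_derivative_zero_constant[of I f])
  show "convex I" using assms(1) by (simp add: open_interval_def is_interval_convex_1)
  show "(f has_vector_derivative 0) (at s within I)" if "s \<in> I" for s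
    using assms(2)[OF that] by (rule has_vector_derivative_at_within)
qed (use that in blast)

lemma constant_derivative_zero:
  assumes "open I" "s \<in> I" "\<And>s. s \<in> I \<Longrightarrow> f s = c" "(f has_vector_derivative d) (at s)"
  shows "d = 0"
proof -
  have "(f has_vector_derivative 0) (at s)"
    by (rule has_vector_derivative_transform_within_open[OF has_vector_derivative_const assms(1,2)])
      (simp add: assms(3))
  then show ?thesis using assms(4) vector_derivative_unique_at by metis
qed

lemma continuous_on_derivative:
  assumes "\<And>s. s \<in> I \<Longrightarrow> (f has_vector_derivative g s) (at s)"
  shows "continuous_on I f"
  using assms by (meson continuous_at_imp_continuous_on has_vector_derivative_continuous)

lemma strictly_increasing_open_image:
  fixes \<sigma> r :: "real \<Rightarrow> real"
  assumes I: "open_interval I"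
    and \<sigma>: "\<And>s. s \<in> I \<Longrightarrow> (\<sigma> has_vector_derivative r s) (at s)" and r: "\<And>s. s \<in> I \<Longrightarrow> r s > 0"
  shows "open (\<sigma> ` I)"
proof (rule invariance_of_domain)
  show "continuous_on I \<sigma>" by (rule continuous_on_derivative[OF \<sigma>])
  show "open I" using I by (simp add: open_interval_def)
  have less: "\<sigma> u < \<sigma> v" if "u \<in> I" "v \<in> I" "u < v" for u v
  proof (rule DERIV_pos_imp_increasing[OF \<open>u < v\<close>])
    fix s assume "u \<le> s" "s \<le> v"
    then have "s \<in> I" using I that unfolding open_interval_def is_interval_1 by blast
    then show "\<exists>y. DERIV \<sigma> s :> y \<and> 0 < y"
      using \<sigma> r by (auto simp: has_real_derivative_iff_has_vector_derivative)
  qed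
  show "inj_on \<sigma> I"
    by (rule linorder_inj_onI) (use less in force)+
qed

text \<open>
  Smoothness is stated through iterated derivatives of one function. For products and quotients an
  inductive formulation is more convenient, in which a derivative need only be given on \<open>I\<close>.
\<close>

fun differentiable_times :: "nat \<Rightarrow> real set \<Rightarrow> (real \<Rightarrow> 'v::real_normed_vector) \<Rightarrow> bool" where
  "differentiable_times 0 I f \<longleftrightarrow> True"
| "differentiable_times (Suc k) I f \<longleftrightarrow>
     (\<exists>g. (\<forall>s\<in>I. (f has_vector_derivative g s) (at s)) \<and> differentiable_times k I g)"

lemma differentiable_times_cong:
  assumes "open I" "\<And>s. s \<in> I \<Longrightarrow> f s = g s" "differentiable_times k I f"
  shows "differentiable_times k I g"
  using assms by (cases k) (auto intro: has_vector_derivative_transform_within_open)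

lemma differentiable_times_mono: "differentiable_times (Suc k) I f \<Longrightarrow> differentiable_times k I f"
proof (induction k arbitrary: f)
  case (Suc k)
  from Suc.prems obtain g where "\<forall>s\<in>I. (f has_vector_derivative g s) (at s)"
    "differentiable_times (Suc k) I g" by (auto simp del: differentiable_times.simps(2)
        simp: differentiable_times.simps(2)[of "Suc k"])
  then show ?case using Suc.IH by auto
qed simp

lemma smooth_curve_derivative:
  assumes "smooth_curve I c" "s \<in> I"
  shows "(c has_vector_derivative curve_deriv c s) (at s)"
  using assms unfolding smooth_curve_def curve_deriv_def
  by (metis funpow_0 vector_derivative_works)

lemma smooth_curve_curve_deriv:
  assumes "smooth_curve I c"
  shows "smooth_curve I (curve_deriv c)"
  unfolding smooth_curve_def
proof (intro allI ballI)
  fix k s assume "s \<in> I"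
  then have "(curve_deriv ^^ Suc k) c differentiable (at s)"
    using assms unfolding smooth_curve_def by blast
  then show "(curve_deriv ^^ k) (curve_deriv c) differentiable (at s)"
    by (simp add: funpow_swap1)
qed

lemma curve_deriv_eqI: "(c has_vector_derivative d) (at s) \<Longrightarrow> curve_deriv c s = d"
  by (simp add: curve_deriv_def vector_derivative_at)

lemma smooth_curve_iff_differentiable_times:
  assumes "open I"
  shows "smooth_curve I f \<longleftrightarrow> (\<forall>k. differentiable_times k I f)"
proof
  assume f: "smooth_curve I f"
  show "\<forall>k. differentiable_times k I f"
  proof
    fix k from f show "differentiable_times k I f"
    proof (induction k arbitrary: f)
      case (Suc k)
      then show ?case by (auto intro!: exI[of _ "curve_deriv f"] smooth_curve_derivative smooth_curve_curve_deriv)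
    qed simp
  qed
next
  assume f: "\<forall>k. differentiable_times k I f"
  have "(curve_deriv ^^ k) f differentiable (at s)" if "s \<in> I" "differentiable_times (Suc k) I f" for k s
    using that
  proof (induction k arbitrary: f)
    case 0
    then show ?case using differentiableI_vector by auto
  next
    case (Suc k)
    then obtain g where g: "\<forall>s\<in>I. (f has_vector_derivative g s) (at s)"
      "differentiable_times (Suc k) I g" by auto
    have "differentiable_times (Suc k) I (curve_deriv f)"
      by (rule differentiable_times_cong[OF assms _ g(2)]) (use g(1) in \<open>auto simp: curve_deriv_eqI\<close>)
    then show ?case using Suc by (simp add: funpow_swap1)
  qed
  then show "smooth_curve I f" using f unfolding smooth_curve_def by blast
qed

lemma differentiable_times_add:
  "differentiable_times k I f \<Longrightarrow> differentiable_times k I g \<Longrightarrow> differentiable_times k I (\<lambda>s. f s + g s)"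
proof (induction k arbitrary: f g)
  case (Suc k)
  then obtain f' g' where
    "\<forall>s\<in>I. (f has_vector_derivative f' s) (at s)" "differentiable_times k I f'"
    "\<forall>s\<in>I. (g has_vector_derivative g' s) (at s)" "differentiable_times k I g'" by auto
  then show ?case
    using Suc.IH[of f' g'] by (auto intro!: exI[of _ "\<lambda>s. f' s + g' s"] has_vector_derivative_add)
qed simp

lemma differentiable_times_bilinear:
  assumes "bounded_bilinear b"
  shows "differentiable_times k I f \<Longrightarrow> differentiable_times k I g \<Longrightarrow>
    differentiable_times k I (\<lambda>s. b (f s) (g s))"
proof (induction k arbitrary: f g)
  case (Suc k)
  then obtain f' g' where fg:
    "\<forall>s\<in>I. (f has_vector_derivative f' s) (at s)" "differentiable_times k I f'"
    "\<forall>s\<in>I. (g has_vector_derivative g' s) (at s)" "differentiable_times k I g'" by auto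
  have "differentiable_times k I (\<lambda>s. b (f s) (g' s) + b (f' s) (g s))"
    by (intro differentiable_times_add Suc.IH fg differentiable_times_mono[OF Suc.prems(1)]
        differentiable_times_mono[OF Suc.prems(2)])
  moreover have "((\<lambda>s. b (f s) (g s)) has_vector_derivative b (f s) (g' s) + b (f' s) (g s)) (at s)"
    if "s \<in> I" for s
    using fg that by (intro bounded_bilinear.has_vector_derivative[OF assms]) auto
  ultimately show ?case
    by (auto intro!: exI[of _ "\<lambda>s. b (f s) (g' s) + b (f' s) (g s)"])
qed simp

lemma differentiable_times_const: "differentiable_times k I (\<lambda>s. c)"
proof (induction k arbitrary: c)
  case (Suc k)
  then show ?case
    unfolding differentiable_times.simps by (intro exI[of _ "\<lambda>s. 0"] conjI ballI) simp_all
qed simp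

text \<open>
  Induction works because the derivative of \<open>1 / f\<close> is a polynomial in \<open>f'\<close> and \<open>1 / f\<close> itself.
\<close>

lemma differentiable_times_inverse:
  fixes f :: "real \<Rightarrow> real"
  assumes "\<And>s. s \<in> I \<Longrightarrow> f s \<noteq> 0"
  shows "differentiable_times k I f \<Longrightarrow> differentiable_times k I (\<lambda>s. inverse (f s))"
proof (induction k)
  case (Suc k)
  then obtain f' where f':
    "\<forall>s\<in>I. (f has_vector_derivative f' s) (at s)" "differentiable_times k I f'" by auto
  note mult = differentiable_times_bilinear[OF bounded_bilinear_mult]
  have inv: "differentiable_times k I (\<lambda>s. inverse (f s))"
    by (rule Suc.IH[OF differentiable_times_mono[OF Suc.prems]])
  have smooth: "differentiable_times k I (\<lambda>s. (- 1) * ((inverse (f s) * f' s) * inverse (f s)))"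
    by (rule mult[OF differentiable_times_const mult[OF mult[OF inv f'(2)] inv]])
  have deriv: "((\<lambda>s. inverse (f s)) has_vector_derivative
      (- 1) * ((inverse (f s) * f' s) * inverse (f s))) (at s)" if "s \<in> I" for s
    using f'(1) that DERIV_inverse'[of f "f' s" s UNIV] assms[OF that]
    unfolding has_real_derivative_iff_has_vector_derivative by simp
  show ?case
    unfolding differentiable_times.simps by (rule exI, intro conjI ballI, erule deriv, rule smooth)
qed simp

lemma smooth_curve_add:
  assumes "open I" "smooth_curve I f" "smooth_curve I g"
  shows "smooth_curve I (\<lambda>s. f s + g s)"
  using assms by (simp add: smooth_curve_iff_differentiable_times differentiable_times_add)

lemma smooth_curve_bilinear:
  assumes "bounded_bilinear b" "open I" "smooth_curve I f" "smooth_curve I g"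
  shows "smooth_curve I (\<lambda>s. b (f s) (g s))"
  using assms by (simp add: smooth_curve_iff_differentiable_times differentiable_times_bilinear)

lemma smooth_curve_inverse:
  fixes f :: "real \<Rightarrow> real"
  assumes "open I" "smooth_curve I f" "\<And>s. s \<in> I \<Longrightarrow> f s \<noteq> 0"
  shows "smooth_curve I (\<lambda>s. inverse (f s))"
  using assms by (simp add: smooth_curve_iff_differentiable_times differentiable_times_inverse)

lemma smooth_curve_const: "open I \<Longrightarrow> smooth_curve I (\<lambda>s. c)"
  by (simp add: smooth_curve_iff_differentiable_times differentiable_times_const)

lemma smooth_curve_antiderivative:
  assumes "open I" "smooth_curve I f" "\<And>s. s \<in> I \<Longrightarrow> (F has_vector_derivative f s) (at s)"
  shows "smooth_curve I F"
proof -
  have "differentiable_times k I F" for k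
    using assms by (cases k) (auto simp: smooth_curve_iff_differentiable_times)
  then show ?thesis by (simp add: smooth_curve_iff_differentiable_times assms(1))
qed

section \<open>The minimal surface equation for ruled surfaces\<close>

lemma ruled_map_has_derivative:
  assumes "(\<gamma> has_vector_derivative \<gamma>') (at s)" "(x has_vector_derivative x') (at s)"
  shows "(ruled_map \<gamma> x has_derivative (\<lambda>h. fst h *\<^sub>R (t *\<^sub>R \<gamma>' + x') + snd h *\<^sub>R \<gamma> s)) (at (s, t))"
proof -
  have fst: "((\<lambda>z. c (fst z)) has_derivative (\<lambda>h. fst h *\<^sub>R c')) (at (s, t))"
    if "(c has_vector_derivative c') (at s)" for c c'
    using has_derivative_compose[of fst fst "(s, t)" UNIV c "\<lambda>h. h *\<^sub>R c'"] that
    by (simp add: has_vector_derivative_def has_derivative_fst)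
  have "((\<lambda>z. snd z *\<^sub>R \<gamma> (fst z) + x (fst z)) has_derivative
      (\<lambda>h. (t *\<^sub>R (fst h *\<^sub>R \<gamma>') + snd h *\<^sub>R \<gamma> s) + fst h *\<^sub>R x')) (at (s, t))"
    using fst[OF assms(1)] fst[OF assms(2)]
    by (auto intro!: derivative_eq_intros)
  then show ?thesis
    by (simp add: ruled_map_def case_prod_beta' algebra_simps)
qed

lemma partial_ruled_map:
  assumes "(\<gamma> has_vector_derivative \<gamma>') (at s)" "(x has_vector_derivative x') (at s)"
  shows "partial dir1 (ruled_map \<gamma> x) (s, t) = t *\<^sub>R \<gamma>' + x'"
    and "partial dir2 (ruled_map \<gamma> x) (s, t) = \<gamma> s"
  unfolding partial_def frechet_derivative_at[OF ruled_map_has_derivative[OF assms], symmetric]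
  by simp_all

lemma partial_cong:
  assumes "open U" "z \<in> U" "\<And>y. y \<in> U \<Longrightarrow> f y = g y" "g differentiable (at z)"
  shows "partial d f z = partial d g z"
proof -
  from assms(4) have "(g has_derivative frechet_derivative g (at z)) (at z)"
    by (simp add: frechet_derivative_works)
  then have "(f has_derivative frechet_derivative g (at z)) (at z)"
    by (rule has_derivative_transform_within_open) (use assms in auto)
  then show ?thesis unfolding partial_def by (metis frechet_derivative_at)
qed

text \<open>
  Each first partial derivative of a ruled map is, above \<open>I\<close>, again a ruled map: the one built from
  \<open>\<gamma>'\<close> and \<open>x'\<close>, and the one with zero direction and base \<open>\<gamma>\<close>. So the formula for first partial
  derivatives also gives the second ones.
\<close>

lemma second_partials_ruled_map:
  assumes "open I" "s \<in> I" "smooth_curve I \<gamma>" "smooth_curve I x"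
  defines "f \<equiv> ruled_map \<gamma> x"
  shows "partial dir1 (partial dir1 f) (s, t) =
      t *\<^sub>R curve_deriv (curve_deriv \<gamma>) s + curve_deriv (curve_deriv x) s"
    and "partial dir2 (partial dir1 f) (s, t) = curve_deriv \<gamma> s"
    and "partial dir2 (partial dir2 f) (s, t) = 0"
proof -
  note d = smooth_curve_derivative[OF assms(3)] smooth_curve_derivative[OF assms(4)]
  note d2 = smooth_curve_derivative[OF smooth_curve_curve_deriv[OF assms(3)]]
    smooth_curve_derivative[OF smooth_curve_curve_deriv[OF assms(4)]]
  have U: "open (I \<times> UNIV)" "(s, t) \<in> I \<times> (UNIV :: real set)"
    using assms by (auto intro: open_Times)
  have f1: "partial dir1 f z = ruled_map (curve_deriv \<gamma>) (curve_deriv x) z" if "z \<in> I \<times> UNIV" for z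
    using that partial_ruled_map(1)[OF d] by (auto simp: f_def ruled_map_def)
  have f2: "partial dir2 f z = ruled_map (\<lambda>_. 0) \<gamma> z" if "z \<in> I \<times> UNIV" for z
    using that partial_ruled_map(2)[OF d] by (auto simp: f_def ruled_map_def)
  have diff: "ruled_map (curve_deriv \<gamma>) (curve_deriv x) differentiable (at (s, t))"
    using ruled_map_has_derivative[OF d2] assms(2) unfolding differentiable_def by blast
  have diff0: "ruled_map (\<lambda>_. 0) \<gamma> differentiable (at (s, t))"
    using ruled_map_has_derivative[OF has_vector_derivative_const d(1)] assms(2)
    unfolding differentiable_def by blast
  show "partial dir1 (partial dir1 f) (s, t) =
      t *\<^sub>R curve_deriv (curve_deriv \<gamma>) s + curve_deriv (curve_deriv x) s"
    using partial_cong[OF U f1 diff] partial_ruled_map(1)[OF d2] assms(2) by simp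
  show "partial dir2 (partial dir1 f) (s, t) = curve_deriv \<gamma> s"
    using partial_cong[OF U f1 diff] partial_ruled_map(2)[OF d2] assms(2) by simp
  show "partial dir2 (partial dir2 f) (s, t) = 0"
    using partial_cong[OF U f2 diff0]
      partial_ruled_map(2)[OF has_vector_derivative_const d(1)] assms(2) by simp
qed

text \<open>
  Since \<open>f\<^sub>t\<^sub>t = 0\<close>, the coefficient \<open>h\<^sub>2\<^sub>2\<close> vanishes and \<open>H = 0\<close> says that
  \<open>g\<^sub>2\<^sub>2 f\<^sub>s\<^sub>s - 2 g\<^sub>1\<^sub>2 f\<^sub>s\<^sub>t\<close> is tangent. This is the only form in which minimality is used.
\<close>

lemma minimal_ruled_surface_equation:
  assumes S: "ruled_surface I \<gamma> x" and H: "minimal_on p (I \<times> UNIV) (ruled_map \<gamma> x)" and s: "s \<in> I"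
  defines "F \<equiv> \<lambda>t. t *\<^sub>R curve_deriv \<gamma> s + curve_deriv x s"
  shows "pscal p (F t) (F t) * pscal p (\<gamma> s) (\<gamma> s) - (pscal p (F t) (\<gamma> s))\<^sup>2 \<noteq> 0"
    and "\<exists>\<alpha> \<beta>. pscal p (\<gamma> s) (\<gamma> s) *\<^sub>R
           (t *\<^sub>R curve_deriv (curve_deriv \<gamma>) s + curve_deriv (curve_deriv x) s)
         - (2 * pscal p (F t) (\<gamma> s)) *\<^sub>R curve_deriv \<gamma> s = \<alpha> *\<^sub>R F t + \<beta> *\<^sub>R \<gamma> s"
proof -
  let ?f = "ruled_map \<gamma> x" and ?z = "(s, t)"
  have smooth: "open I" "smooth_curve I \<gamma>" "smooth_curve I x"
    using S by (auto simp: ruled_surface_def regular_curve_def open_interval_def)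
  have p1: "partial dir1 ?f ?z = F t" and p2: "partial dir2 ?f ?z = \<gamma> s"
    using partial_ruled_map[OF smooth_curve_derivative smooth_curve_derivative] smooth s
    by (auto simp: F_def)
  note p12 = second_partials_ruled_map[OF smooth(1) s smooth(2,3)]
  have H': "metric_det p ?f ?z \<noteq> 0" "mean_curvature p ?f ?z = 0"
    using H s by (auto simp: minimal_on_def)
  show det: "pscal p (F t) (F t) * pscal p (\<gamma> s) (\<gamma> s) - (pscal p (F t) (\<gamma> s))\<^sup>2 \<noteq> 0"
    using H'(1) by (simp add: metric_det_def metric_coeff_def p1 p2)
  define T where "T = span {F t, \<gamma> s}"
  have T: "tangent_space ?f ?z = T" by (simp add: tangent_space_def p1 p2 T_def)
  define A where "A = t *\<^sub>R curve_deriv (curve_deriv \<gamma>) s + curve_deriv (curve_deriv x) s"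
  define B where "B = curve_deriv \<gamma> s"
  define h where "h = normal_part p T"
  have tangent: "v - h v \<in> T" for v
    unfolding T_def h_def by (rule normal_part_difference_tangent[OF det])
  let ?E = "pscal p (F t) (F t)" and ?F = "pscal p (F t) (\<gamma> s)" and ?G = "pscal p (\<gamma> s) (\<gamma> s)"
  have "?E *\<^sub>R h 0 - (2 * ?F) *\<^sub>R h B + ?G *\<^sub>R h A = 0"
    using H' by (simp add: mean_curvature_def metric_coeff_def second_form_coeff_def p1 p2 p12 T
        A_def B_def h_def)
  \<comment> \<open>Replacing each normal part by the vector itself costs only a tangent vector.\<close>
  then have "?G *\<^sub>R A - (2 * ?F) *\<^sub>R B =
      ?G *\<^sub>R (A - h A) - (2 * ?F) *\<^sub>R (B - h B) + ?E *\<^sub>R (0 - h 0)"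
    by (simp add: algebra_simps)
  also have "\<dots> \<in> T"
    unfolding T_def
    by (rule span_add[OF span_diff[OF span_scale span_scale] span_scale];
        rule tangent[unfolded T_def])
  finally show "\<exists>\<alpha> \<beta>. ?G *\<^sub>R
           (t *\<^sub>R curve_deriv (curve_deriv \<gamma>) s + curve_deriv (curve_deriv x) s)
         - (2 * ?F) *\<^sub>R curve_deriv \<gamma> s = \<alpha> *\<^sub>R F t + \<beta> *\<^sub>R \<gamma> s"
    unfolding A_def B_def T_def mem_span_pair .
qed

text \<open>
  Rescaling the direction and sliding the base curve along the rulings changes neither the rulings nor
  the surface.
\<close>

lemma ruled_image_reparametrization:
  assumes "\<And>s. s \<in> I \<Longrightarrow> \<rho> s \<noteq> 0"
    and "\<And>s. s \<in> I \<Longrightarrow> N s = \<rho> s *\<^sub>R \<gamma> s" and "\<And>s. s \<in> I \<Longrightarrow> y s = x s + \<tau> s *\<^sub>R N s"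
  shows "ruled_map N y ` (I \<times> UNIV) = ruled_map \<gamma> x ` (I \<times> UNIV)"
proof (intro equalityI subsetI)
  fix v assume "v \<in> ruled_map N y ` (I \<times> UNIV)"
  then obtain s t where st: "s \<in> I" "v = t *\<^sub>R N s + y s" by (auto simp: ruled_map_def)
  then have "v = ruled_map \<gamma> x (s, (t + \<tau> s) * \<rho> s)"
    by (simp add: assms ruled_map_def algebra_simps)
  then show "v \<in> ruled_map \<gamma> x ` (I \<times> UNIV)" using st(1) by blast
next
  fix v assume "v \<in> ruled_map \<gamma> x ` (I \<times> UNIV)"
  then obtain s t where st: "s \<in> I" "v = t *\<^sub>R \<gamma> s + x s" by (auto simp: ruled_map_def)
  then have "v = ruled_map N y (s, t / \<rho> s - \<tau> s)"
    by (simp add: assms ruled_map_def algebra_simps)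
  then show "v \<in> ruled_map N y ` (I \<times> UNIV)" using st(1) by blast
qed

text \<open>
  The zero set is closed by continuity and open by non-singularity, and an interval is connected.
\<close>

lemma nonsingular_zero_dichotomy:
  fixes \<phi> :: "real \<Rightarrow> real"
  assumes I: "open_interval I" and \<phi>: "continuous_on I \<phi>"
    and ns: "\<And>s. s \<in> I \<Longrightarrow> \<not> (\<phi> s = 0 \<and> frequently (\<lambda>s. \<phi> s \<noteq> 0) (nhds s))"
  shows "(\<forall>s\<in>I. \<phi> s = 0) \<or> (\<forall>s\<in>I. \<phi> s \<noteq> 0)"
proof -
  have I': "open I" "connected I" using I by (auto simp: open_interval_def is_interval_connected)
  have eq: "{s \<in> I. \<phi> s = 0} = I \<inter> interior {s. \<phi> s = 0}"
  proof (intro equalityI subsetI)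
    fix s assume "s \<in> {s \<in> I. \<phi> s = 0}"
    then have "eventually (\<lambda>s. \<phi> s = 0) (nhds s)" "s \<in> I"
      using ns[of s] by (auto simp: frequently_def)
    then show "s \<in> I \<inter> interior {s. \<phi> s = 0}"
      by (auto simp: eventually_nhds interior_def)
  qed (use interior_subset in blast)
  have "openin (top_of_set I) {s \<in> I. \<phi> s = 0}"
    unfolding eq by (simp add: openin_open_Int)
  moreover have "closedin (top_of_set I) {s \<in> I. \<phi> s = 0}"
    using continuous_closedin_preimage_constant[OF \<phi>, of 0] by simp
  ultimately have "{s \<in> I. \<phi> s = 0} = {} \<or> {s \<in> I. \<phi> s = 0} = I"
    using I'(2) connected_clopen by blast
  then show ?thesis by blast
qed

section \<open>Null rulings\<close>

text \<open>
  If \<open>\<langle>\<gamma>, \<gamma>\<rangle> = 0\<close>, the minimal surface equation says that \<open>\<gamma>'\<close> is tangent; as \<open>\<gamma>'\<close> is orthogonal to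
  \<open>\<gamma>\<close> while \<open>x'\<close> is not, \<open>\<gamma>'\<close> is a multiple of \<open>\<gamma>\<close>. So the direction is constant up to a factor, and
  sliding the base curve along the rulings by a suitable amount, found by one quadrature, makes it null.
\<close>

lemma null_ruling_minimal_cylinder:
  assumes S: "ruled_surface I \<gamma> x" and H: "minimal_on p (I \<times> UNIV) (ruled_map \<gamma> x)"
    and null: "\<And>s. s \<in> I \<Longrightarrow> pscal p (\<gamma> s) (\<gamma> s) = 0"
  shows "minimal_cylinder p (ruled_map \<gamma> x ` (I \<times> UNIV))"
proof -
  let ?g1 = "curve_deriv \<gamma>" and ?x1 = "curve_deriv x"
  have I: "open_interval I" "open I" and "0 \<in> I" and smooth: "smooth_curve I \<gamma>" "smooth_curve I x"
    and nz: "\<And>s. s \<in> I \<Longrightarrow> \<gamma> s \<noteq> 0"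
    using S by (auto simp: ruled_surface_def regular_curve_def open_interval_def)
  note d = smooth_curve_derivative[OF smooth(1)] smooth_curve_derivative[OF smooth(2)]
    smooth_curve_derivative[OF smooth_curve_curve_deriv[OF smooth(1)]]
    smooth_curve_derivative[OF smooth_curve_curve_deriv[OF smooth(2)]]
  note cont = d[THEN continuous_on_derivative]
  have g1: "pscal p (?g1 s) (\<gamma> s) = 0" if s: "s \<in> I" for s
  proof -
    have "((\<lambda>s. pscal p (\<gamma> s) (\<gamma> s)) has_vector_derivative
        pscal p (\<gamma> s) (?g1 s) + pscal p (?g1 s) (\<gamma> s)) (at s)"
      by (intro pscal.has_vector_derivative d s)
    from constant_derivative_zero[OF I(2) s null this] show ?thesis
      by (simp add: pscal_commute[of p "\<gamma> s" "?g1 s"])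
  qed
  have x1: "pscal p (?x1 s) (\<gamma> s) \<noteq> 0" if s: "s \<in> I" for s
    using minimal_ruled_surface_equation(1)[OF S H s, of 0] null[OF s] by simp
  have parallel: "\<exists>a. ?g1 s = a *\<^sub>R \<gamma> s" if s: "s \<in> I" for s
  proof -
    obtain \<alpha> \<beta> where eq: "- (2 * pscal p (?x1 s) (\<gamma> s)) *\<^sub>R ?g1 s = \<alpha> *\<^sub>R ?x1 s + \<beta> *\<^sub>R \<gamma> s"
      using minimal_ruled_surface_equation(2)[OF S H s, of 0] null[OF s] by auto
    then have "pscal p (- (2 * pscal p (?x1 s) (\<gamma> s)) *\<^sub>R ?g1 s) (\<gamma> s) =
        pscal p (\<alpha> *\<^sub>R ?x1 s + \<beta> *\<^sub>R \<gamma> s) (\<gamma> s)" by simp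
    then have "\<alpha> = 0"
      using x1[OF s] by (simp add: pscal_expand g1[OF s] null[OF s])
    define c where "c = - (2 * pscal p (?x1 s) (\<gamma> s))"
    have "c \<noteq> 0" using x1[OF s] by (simp add: c_def)
    then have "?g1 s = inverse c *\<^sub>R (c *\<^sub>R ?g1 s)" by simp
    also have "c *\<^sub>R ?g1 s = \<beta> *\<^sub>R \<gamma> s" using eq \<open>\<alpha> = 0\<close> by (simp add: c_def)
    finally have "?g1 s = (inverse c * \<beta>) *\<^sub>R \<gamma> s" by simp
    then show ?thesis by blast
  qed
  define a where "a = (\<lambda>s. pscal p (?g1 s) (?x1 s) / pscal p (\<gamma> s) (?x1 s))"
  have x1': "pscal p (\<gamma> s) (?x1 s) \<noteq> 0" if "s \<in> I" for s
    using x1[OF that] by (simp add: pscal_commute)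
  have g1a: "?g1 s = a s *\<^sub>R \<gamma> s" if s: "s \<in> I" for s
    using parallel[OF s] x1'[OF s] by (auto simp: a_def pscal_expand)
  have "continuous_on I a"
    unfolding a_def using x1' by (intro continuous_on_divide pscal.continuous_on cont) auto
  then obtain A where A: "\<And>s. s \<in> I \<Longrightarrow> (A has_vector_derivative a s) (at s)"
    using antiderivative_on_open_interval[OF I(1)] by blast
  have "((\<lambda>s. exp (- A s) *\<^sub>R \<gamma> s) has_vector_derivative 0) (at s)" if s: "s \<in> I" for s
  proof -
    have "((\<lambda>s. exp (- A s)) has_real_derivative exp (- A s) * - a s) (at s)"
      using A[OF s] by (auto intro!: derivative_eq_intros
          simp: has_real_derivative_iff_has_vector_derivative[symmetric])
    from has_vector_derivative_scaleR[OF this d(1)[OF s]] show ?thesis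
      by (simp add: g1a[OF s])
  qed
  then obtain \<gamma>0 where "\<And>s. s \<in> I \<Longrightarrow> exp (- A s) *\<^sub>R \<gamma> s = \<gamma>0"
    using zero_derivative_constant[OF I(1)] by blast
  then have \<gamma>0: "\<gamma>0 = exp (- A s) *\<^sub>R \<gamma> s" if "s \<in> I" for s using that by simp
  have \<gamma>0_null: "pscal p \<gamma>0 \<gamma>0 = 0" "\<gamma>0 \<noteq> 0"
    using \<gamma>0[OF \<open>0 \<in> I\<close>] null nz \<open>0 \<in> I\<close> by (auto simp: pscal_expand)
  have \<gamma>0x: "pscal p \<gamma>0 (?x1 s) \<noteq> 0" if "s \<in> I" for s
    using \<gamma>0[OF that] x1'[OF that] by (simp add: pscal_expand)
  \<comment> \<open>The derivative of the displacement \<open>\<tau>\<close> for which \<open>x + \<tau> \<gamma>0\<close> is null: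
     \<open>\<langle>x', x'\<rangle> + 2 \<tau>' \<langle>\<gamma>0, x'\<rangle> = 0\<close>.\<close>
  define \<tau>1 where "\<tau>1 = (\<lambda>s. pscal p (?x1 s) (?x1 s) * (- 1 / 2 * inverse (pscal p \<gamma>0 (?x1 s))))"
  have smooth1: "smooth_curve I \<tau>1"
    unfolding \<tau>1_def
    by (intro smooth_curve_bilinear[OF bounded_bilinear_mult] smooth_curve_inverse
        smooth_curve_bilinear[OF pscal.bounded_bilinear_axioms] smooth_curve_const
        smooth_curve_curve_deriv smooth I \<gamma>0x)
  then obtain \<tau> where \<tau>: "\<And>s. s \<in> I \<Longrightarrow> (\<tau> has_vector_derivative \<tau>1 s) (at s)"
    using antiderivative_on_open_interval[OF I(1)] continuous_on_derivative smooth_curve_derivative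
    by metis
  define y where "y = (\<lambda>s. x s + \<tau> s *\<^sub>R \<gamma>0)"
  have "smooth_curve I y"
    unfolding y_def
    by (intro smooth_curve_add smooth_curve_bilinear[OF bounded_bilinear_scaleR] smooth_curve_const
        smooth_curve_antiderivative[OF I(2) smooth1 \<tau>] smooth I)
  have y1: "curve_deriv y s = ?x1 s + \<tau>1 s *\<^sub>R \<gamma>0" if s: "s \<in> I" for s
    unfolding y_def
    by (rule curve_deriv_eqI, rule has_vector_derivative_add[OF d(2)[OF s]])
      (use \<tau>[OF s] in \<open>auto intro!: derivative_eq_intros
        simp: has_real_derivative_iff_has_vector_derivative\<close>)
  have y1_\<gamma>0: "pscal p \<gamma>0 (curve_deriv y s) = pscal p \<gamma>0 (?x1 s)" if "s \<in> I" for s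
    by (simp add: y1 that pscal_expand \<gamma>0_null)
  have "null_curve p I y"
    unfolding null_curve_def regular_curve_def
  proof (intro conjI ballI \<open>smooth_curve I y\<close>)
    fix s assume s: "s \<in> I"
    show "curve_deriv y s \<noteq> 0" using y1_\<gamma>0[OF s] \<gamma>0x[OF s] by (auto simp: pscal_expand)
    show "pscal p (curve_deriv y s) (curve_deriv y s) = 0"
      using \<gamma>0x[OF s] pscal_commute[of p "?x1 s" \<gamma>0]
      by (simp add: y1[OF s] pscal_expand \<gamma>0_null \<tau>1_def field_simps)
  qed
  moreover have "ruled_map \<gamma> x ` (I \<times> UNIV) = (\<lambda>(s, t). t *\<^sub>R \<gamma>0 + y s) ` (I \<times> UNIV)"
    using ruled_image_reparametrization[of I "\<lambda>s. exp (- A s)" "\<lambda>s. \<gamma>0" \<gamma> y x \<tau>] \<gamma>0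
    by (simp add: y_def ruled_map_def)
  ultimately show ?thesis
    unfolding minimal_cylinder_def null_vector_def
    using I(1) \<gamma>0_null \<gamma>0x y1_\<gamma>0 by metis
qed

section \<open>Rulings of unit length orthogonal to the base curve\<close>

text \<open>
  A minimal ruled surface with non-null rulings, parametrized so that \<open>g\<^sub>1\<^sub>2 = 0\<close> and \<open>g\<^sub>2\<^sub>2 = \<epsilon>\<close>. The
  functions \<open>N1, N2\<close> and \<open>x1, x2\<close> are the derivatives of the direction \<open>N\<close> and the base curve \<open>x\<close>.
  Here the metric is non-degenerate iff \<open>g\<^sub>1\<^sub>1\<close> does not vanish, and the minimal surface equation
  says that \<open>f\<^sub>s\<^sub>s\<close> is tangent.
\<close>

locale orthogonal_ruling =
  fixes p :: nat and I :: "real set" and \<epsilon> :: real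
    and N N1 N2 x x1 x2 :: "real \<Rightarrow> 'n::{finite,linorder} coords"
  assumes I: "open_interval I"
    and N: "s \<in> I \<Longrightarrow> (N has_vector_derivative N1 s) (at s)"
    and N1: "s \<in> I \<Longrightarrow> (N1 has_vector_derivative N2 s) (at s)"
    and x: "s \<in> I \<Longrightarrow> (x has_vector_derivative x1 s) (at s)"
    and x1: "s \<in> I \<Longrightarrow> (x1 has_vector_derivative x2 s) (at s)"
    and cont: "continuous_on I N2" "continuous_on I x2"
    and unit: "s \<in> I \<Longrightarrow> pscal p (N s) (N s) = \<epsilon>" and eps: "\<epsilon> = 1 \<or> \<epsilon> = - 1"
    and orth: "s \<in> I \<Longrightarrow> pscal p (N s) (x1 s) = 0"
    and regular: "s \<in> I \<Longrightarrow> pscal p (t *\<^sub>R N1 s + x1 s) (t *\<^sub>R N1 s + x1 s) \<noteq> 0"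
    and minimal: "s \<in> I \<Longrightarrow>
      \<exists>\<alpha> \<beta>. t *\<^sub>R N2 s + x2 s = \<alpha> *\<^sub>R (t *\<^sub>R N1 s + x1 s) + \<beta> *\<^sub>R N s"
begin

lemma open_I: "open I"
  using I by (simp add: open_interval_def)

lemma N_N1: "pscal p (N s) (N1 s) = 0" if s: "s \<in> I"
  using constant_derivative_zero[OF open_I s unit pscal.has_vector_derivative[OF N[OF s] N[OF s]]]
  by (simp add: pscal_commute[of p "N1 s"])

lemma N_N2: "pscal p (N s) (N2 s) = - pscal p (N1 s) (N1 s)" if s: "s \<in> I"
  using constant_derivative_zero[OF open_I s N_N1 pscal.has_vector_derivative[OF N[OF s] N1[OF s]]]
  by simp

lemma N_x2: "pscal p (N s) (x2 s) = - pscal p (N1 s) (x1 s)" if s: "s \<in> I"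
  using constant_derivative_zero[OF open_I s orth pscal.has_vector_derivative[OF N[OF s] x1[OF s]]]
  by simp

lemma x1_nonnull: "pscal p (x1 s) (x1 s) \<noteq> 0" if "s \<in> I"
  using regular[OF that, of 0] by simp

text \<open>
  The logarithmic derivative of the speed of the base curve. Carrying it along replaces a
  reparametrization by arc length, and so avoids inverse functions.
\<close>

definition b :: "real \<Rightarrow> real" where
  "b s = pscal p (x1 s) (x2 s) / pscal p (x1 s) (x1 s)"

text \<open>
  The minimal surface equation on the base curve itself (\<open>t = 0\<close>).
\<close>

lemma base_equation: "x2 s = b s *\<^sub>R x1 s - (\<epsilon> * pscal p (N1 s) (x1 s)) *\<^sub>R N s" if s: "s \<in> I"
proof -
  obtain \<alpha> \<beta> where x2: "x2 s = \<alpha> *\<^sub>R x1 s + \<beta> *\<^sub>R N s"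
    using minimal[OF s, of 0] by auto
  have "pscal p (x1 s) (x2 s) = \<alpha> * pscal p (x1 s) (x1 s)"
    unfolding x2 using orth[OF s] by (simp add: pscal_expand pscal_commute[of p "x1 s" "N s"])
  then have "\<alpha> = b s" using x1_nonnull[OF s] by (simp add: b_def)
  moreover have "pscal p (N s) (x2 s) = \<beta> * \<epsilon>"
    unfolding x2 using orth[OF s] unit[OF s] by (simp add: pscal_expand)
  then have "\<beta> = - \<epsilon> * pscal p (N1 s) (x1 s)" using N_x2[OF s] eps by auto
  ultimately show ?thesis using x2 by simp
qed

text \<open>
  With \<open>x2\<close> known, the minimal surface equation at \<open>t = 1\<close> and \<open>t = -1\<close> determines \<open>N2\<close>, because
  \<open>N, N1, x1\<close> are linearly independent: a combination of \<open>N1\<close> and \<open>x1\<close> that vanishes would be, up to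
  a factor, a null tangent vector \<open>t N1 + x1\<close>.
\<close>

lemma direction_equation_nonzero:
  assumes s: "s \<in> I" and nz: "N1 s \<noteq> 0"
  shows "N2 s = b s *\<^sub>R N1 s - (\<epsilon> * pscal p (N1 s) (N1 s)) *\<^sub>R N s"
proof -
  obtain \<alpha> \<beta> where 1: "N2 s + x2 s = \<alpha> *\<^sub>R (N1 s + x1 s) + \<beta> *\<^sub>R N s"
    using minimal[OF s, of 1] by auto
  obtain \<alpha>' \<beta>' where 2: "- N2 s + x2 s = \<alpha>' *\<^sub>R (- N1 s + x1 s) + \<beta>' *\<^sub>R N s"
    using minimal[OF s, of "- 1"] by auto
  define c where "c = \<epsilon> * pscal p (N1 s) (x1 s) + \<epsilon> * pscal p (N1 s) (x1 s) + \<beta> + \<beta>'"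
  define u w where "u = \<alpha> - \<alpha>'" and "w = \<alpha> + \<alpha>' - b s - b s"
  have "u *\<^sub>R N1 s + w *\<^sub>R x1 s + c *\<^sub>R N s = (N2 s + x2 s) + (- N2 s + x2 s) - x2 s - x2 s"
    unfolding 1 2 unfolding base_equation[OF s] u_def w_def c_def
    by (simp add: vec_eq_iff algebra_simps)
  then have "u *\<^sub>R N1 s + w *\<^sub>R x1 s + c *\<^sub>R N s = 0" by simp
  moreover from arg_cong[OF this, of "pscal p (N s)"] have "c = 0"
    using N_N1[OF s] orth[OF s] unit[OF s] eps by (auto simp: pscal_expand)
  ultimately have uw: "u *\<^sub>R N1 s + w *\<^sub>R x1 s = 0" by simp
  have "w = 0"
  proof (rule ccontr)
    assume "w \<noteq> 0"
    then have "(u / w) *\<^sub>R N1 s + x1 s = inverse w *\<^sub>R (u *\<^sub>R N1 s + w *\<^sub>R x1 s)"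
      by (simp add: scaleR_add_right divide_inverse mult.commute)
    then have "(u / w) *\<^sub>R N1 s + x1 s = 0" using uw by simp
    then show False using regular[OF s, of "u / w"] by (simp add: pscal_expand)
  qed
  then have "u = 0" using uw nz by simp
  with \<open>w = 0\<close> have "\<alpha> = b s" by (simp add: u_def w_def)
  then have N2: "N2 s = b s *\<^sub>R N1 s + (\<epsilon> * pscal p (N1 s) (x1 s) + \<beta>) *\<^sub>R N s"
    using 1 unfolding base_equation[OF s] by (simp add: algebra_simps)
  have "pscal p (N s) (N2 s) = (\<epsilon> * pscal p (N1 s) (x1 s) + \<beta>) * \<epsilon>"
    unfolding N2 using N_N1[OF s] unit[OF s] by (simp add: pscal_expand)
  then have "\<epsilon> * pscal p (N1 s) (x1 s) + \<beta> = - \<epsilon> * pscal p (N1 s) (N1 s)"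
    using N_N2[OF s] eps by auto
  then show ?thesis using N2 by simp
qed

lemma continuous_data: "continuous_on I N" "continuous_on I N1" "continuous_on I x1" "continuous_on I b"
proof -
  show "continuous_on I N" "continuous_on I N1" and x1': "continuous_on I x1"
    using continuous_on_derivative N N1 x1 by blast+
  show "continuous_on I b"
    unfolding b_def using x1_nonnull
    by (intro continuous_on_divide pscal.continuous_on x1' cont) auto
qed

text \<open>
  Where \<open>N1\<close> vanishes the argument for \<open>direction_equation_nonzero\<close> breaks down. But near a point where
  the equation fails it fails too, by continuity, so that \<open>N1\<close> vanishes identically there and hence
  \<open>N2\<close> does as well; then both sides are zero.
\<close>

lemma direction_equation:
  assumes s: "s \<in> I"
  shows "N2 s = b s *\<^sub>R N1 s - (\<epsilon> * pscal p (N1 s) (N1 s)) *\<^sub>R N s"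
proof (rule ccontr)
  define Y where "Y s = N2 s - (b s *\<^sub>R N1 s - (\<epsilon> * pscal p (N1 s) (N1 s)) *\<^sub>R N s)" for s
  assume "\<not> ?thesis"
  then have Ys: "s \<in> I \<inter> Y -` (- {0})" using s by (simp add: Y_def)
  have "continuous_on I Y"
    unfolding Y_def by (intro continuous_intros pscal.continuous_on continuous_data cont)
  then have op: "open (I \<inter> Y -` (- {0}))"
    using continuous_open_preimage[OF _ open_I] by blast
  have N1z: "N1 u = 0" if "u \<in> I \<inter> Y -` (- {0})" for u
    using that direction_equation_nonzero[of u] by (auto simp: Y_def)
  have "N2 s = 0"
    by (rule constant_derivative_zero[OF op Ys N1z N1[OF s]])
  then have "Y s = 0" using N1z[OF Ys] by (simp add: Y_def pscal_expand)
  then show False using Ys by simp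
qed

end

text \<open>
  The structure equations after dividing \<open>N'\<close> and \<open>x'\<close> by a speed \<open>r\<close>: with respect to the parameter
  \<open>\<sigma>\<close> they read \<open>N'' = - \<epsilon> k N\<close> and \<open>x'' = - \<epsilon> m N\<close>, with constant coefficients. The condition
  \<open>regular\<close> is what remains of the non-degeneracy of the metric along a whole ruling.
\<close>

locale constant_coefficient_ruling =
  fixes p :: nat and I :: "real set" and \<epsilon> k m \<delta> :: real
    and N G x X :: "real \<Rightarrow> 'n::{finite,linorder} coords" and \<sigma> r :: "real \<Rightarrow> real"
  assumes I: "open_interval I"
    and r: "s \<in> I \<Longrightarrow> r s > 0"
    and \<sigma>: "s \<in> I \<Longrightarrow> (\<sigma> has_vector_derivative r s) (at s)"
    and N: "s \<in> I \<Longrightarrow> (N has_vector_derivative r s *\<^sub>R G s) (at s)"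
    and G: "s \<in> I \<Longrightarrow> (G has_vector_derivative - (\<epsilon> * k * r s) *\<^sub>R N s) (at s)"
    and x: "s \<in> I \<Longrightarrow> (x has_vector_derivative r s *\<^sub>R X s) (at s)"
    and X: "s \<in> I \<Longrightarrow> (X has_vector_derivative - (\<epsilon> * m * r s) *\<^sub>R N s) (at s)"
    and eps: "\<epsilon> = 1 \<or> \<epsilon> = - 1"
    and gram: "s \<in> I \<Longrightarrow> pscal p (N s) (N s) = \<epsilon>" "s \<in> I \<Longrightarrow> pscal p (N s) (G s) = 0"
      "s \<in> I \<Longrightarrow> pscal p (N s) (X s) = 0" "s \<in> I \<Longrightarrow> pscal p (G s) (G s) = k"
      "s \<in> I \<Longrightarrow> pscal p (G s) (X s) = m" "s \<in> I \<Longrightarrow> pscal p (X s) (X s) = \<delta>"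
    and regular: "t\<^sup>2 * k + 2 * t * m + \<delta> \<noteq> 0"

context orthogonal_ruling
begin

text \<open>
  With the speed \<open>r = exp (\<integral> b)\<close> the terms containing \<open>b\<close> cancel. The derivatives of the scaled
  vectors \<open>G\<close> and \<open>X\<close> are then multiples of \<open>N\<close>, to which \<open>G\<close> and \<open>X\<close> are orthogonal, so that all
  their scalar products are constant.
\<close>

lemma constant_coefficients:
  obtains k m \<delta> G X \<sigma> r where "constant_coefficient_ruling p I \<epsilon> k m \<delta> N G x X \<sigma> r"
proof -
  obtain B where B: "\<And>s. s \<in> I \<Longrightarrow> (B has_vector_derivative b s) (at s)"
    using antiderivative_on_open_interval[OF I continuous_data(4)] by blast
  define r where "r s = exp (B s)" for s
  have r_pos: "r s > 0" for s by (simp add: r_def)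
  have "continuous_on I r"
    unfolding r_def using continuous_on_derivative[OF B] by (intro continuous_on_exp) auto
  then obtain \<sigma> where \<sigma>: "\<And>s. s \<in> I \<Longrightarrow> (\<sigma> has_vector_derivative r s) (at s)"
    using antiderivative_on_open_interval[OF I] by blast
  define G where "G s = exp (- B s) *\<^sub>R N1 s" for s
  define X where "X s = exp (- B s) *\<^sub>R x1 s" for s
  have N1_G: "N1 s = r s *\<^sub>R G s" and x1_X: "x1 s = r s *\<^sub>R X s" for s
    by (simp_all add: r_def G_def X_def exp_minus)
  have scaled: "((\<lambda>s. exp (- B s) *\<^sub>R c s) has_vector_derivative exp (- B s) *\<^sub>R (c' - b s *\<^sub>R c s)) (at s)"
    if s: "s \<in> I" and c: "(c has_vector_derivative c') (at s)" for s c c'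
  proof -
    have "((\<lambda>s. exp (- B s)) has_real_derivative exp (- B s) * - b s) (at s)"
      using B[OF s] by (auto intro!: derivative_eq_intros
          simp: has_real_derivative_iff_has_vector_derivative[symmetric])
    from has_vector_derivative_scaleR[OF this c] show ?thesis
      by (simp add: algebra_simps)
  qed
  have G1: "(G has_vector_derivative - (\<epsilon> * pscal p (G s) (G s) * r s) *\<^sub>R N s) (at s)"
    if s: "s \<in> I" for s
  proof -
    have "exp (- B s) *\<^sub>R (N2 s - b s *\<^sub>R N1 s) = - (\<epsilon> * pscal p (G s) (G s) * r s) *\<^sub>R N s"
      unfolding direction_equation[OF s] N1_G
      by (simp add: pscal_expand r_def exp_minus field_simps)
    then show ?thesis using scaled[OF s N1[OF s]] unfolding G_def by simp
  qed
  have X1: "(X has_vector_derivative - (\<epsilon> * pscal p (G s) (X s) * r s) *\<^sub>R N s) (at s)"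
    if s: "s \<in> I" for s
  proof -
    have "exp (- B s) *\<^sub>R (x2 s - b s *\<^sub>R x1 s) = - (\<epsilon> * pscal p (G s) (X s) * r s) *\<^sub>R N s"
      unfolding base_equation[OF s] N1_G x1_X
      by (simp add: pscal_expand r_def exp_minus field_simps)
    then show ?thesis using scaled[OF s x1[OF s]] unfolding X_def by simp
  qed
  have NG: "pscal p (N s) (G s) = 0" "pscal p (G s) (N s) = 0"
    and NX: "pscal p (N s) (X s) = 0" "pscal p (X s) (N s) = 0" if "s \<in> I" for s
    using N_N1[OF that] orth[OF that] pscal_commute[of p "N s"] by (simp_all add: G_def X_def pscal_expand)
  have "((\<lambda>s. pscal p (G s) (G s)) has_vector_derivative 0) (at s)" if s: "s \<in> I" for s
    using pscal.has_vector_derivative[where p = p, OF G1[OF s] G1[OF s]] by (simp add: pscal_expand NG[OF s])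
  then obtain k where k: "\<And>s. s \<in> I \<Longrightarrow> pscal p (G s) (G s) = k"
    using zero_derivative_constant[OF I] by blast
  have "((\<lambda>s. pscal p (G s) (X s)) has_vector_derivative 0) (at s)" if s: "s \<in> I" for s
    using pscal.has_vector_derivative[where p = p, OF G1[OF s] X1[OF s]] by (simp add: pscal_expand NG[OF s] NX[OF s])
  then obtain m where m: "\<And>s. s \<in> I \<Longrightarrow> pscal p (G s) (X s) = m"
    using zero_derivative_constant[OF I] by blast
  have "((\<lambda>s. pscal p (X s) (X s)) has_vector_derivative 0) (at s)" if s: "s \<in> I" for s
    using pscal.has_vector_derivative[where p = p, OF X1[OF s] X1[OF s]] by (simp add: pscal_expand NX[OF s])
  then obtain \<delta> where \<delta>: "\<And>s. s \<in> I \<Longrightarrow> pscal p (X s) (X s) = \<delta>"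
    using zero_derivative_constant[OF I] by blast
  obtain s0 where s0: "s0 \<in> I" using I by (auto simp: open_interval_def)
  have "t\<^sup>2 * k + 2 * t * m + \<delta> \<noteq> 0" for t
  proof -
    have "pscal p (t *\<^sub>R N1 s0 + x1 s0) (t *\<^sub>R N1 s0 + x1 s0) =
        (r s0)\<^sup>2 * (t\<^sup>2 * k + 2 * t * m + \<delta>)"
      unfolding N1_G x1_X k[OF s0, symmetric] m[OF s0, symmetric] \<delta>[OF s0, symmetric]
      by (simp add: pscal_expand pscal_commute[of p "X s0" "G s0"] power2_eq_square algebra_simps)
    then show ?thesis using regular[OF s0, of t] by auto
  qed
  then have "constant_coefficient_ruling p I \<epsilon> k m \<delta> N G x X \<sigma> r"
    using G1 X1 N x by unfold_locales
      (auto simp: I r_pos \<sigma> unit eps k m \<delta> NG NX N1_G[symmetric] x1_X[symmetric])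
  then show ?thesis by (rule that)
qed

end

section \<open>Comparison with the model surfaces\<close>

lemma locally_homotheticI:
  assumes "c > 0" "openin (top_of_set M) ((\<lambda>y. c *\<^sub>R y + b) ` S)"
  shows "locally_homothetic p S M"
proof -
  have "linear_isometry p (\<lambda>v. v)" by (simp add: linear_isometry_def linear_id[unfolded id_def])
  then show ?thesis
    unfolding locally_homothetic_def using assms openin_subtopology_self by blast
qed

text \<open>
  A surface whose rulings \<open>n u\<close> are orthogonal to a fixed non-null axis \<open>v\<close> becomes a piece of the
  model surface after a translation by \<open>- w\<close> and a homothety. The piece is open in the subspace
  topology because the parameter \<open>s\<close> of the model can be read off as the coordinate along the axis;
  this is where it matters that the axis is not null.
\<close>

lemma homothetic_to_conoid:
  fixes N x n :: "real \<Rightarrow> 'n::{finite,linorder} coords"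
  assumes J: "open ((\<lambda>s. \<omega> * \<sigma> s) ` I)" and \<omega>: "\<omega> > 0"
    and N: "\<And>s. s \<in> I \<Longrightarrow> N s = n (\<omega> * \<sigma> s)"
    and x: "\<And>s. s \<in> I \<Longrightarrow> x s = \<mu> *\<^sub>R N s + \<sigma> s *\<^sub>R v + w"
    and v: "pscal p v v \<noteq> 0" and perp: "\<And>u. pscal p (n u) v = 0"
  defines "e \<equiv> (1 / sqrt \<bar>pscal p v v\<bar>) *\<^sub>R v"
  shows "locally_homothetic p (ruled_map N x ` (I \<times> UNIV)) (range (\<lambda>(s, t). t *\<^sub>R n s + s *\<^sub>R e))"
proof (rule locally_homotheticI)
  define c where "c = \<omega> / sqrt \<bar>pscal p v v\<bar>"
  show "c > 0" using \<omega> v by (simp add: c_def)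
  have cv: "c *\<^sub>R v = \<omega> *\<^sub>R e" by (simp add: c_def e_def)
  have e: "pscal p e e \<noteq> 0" and ne: "pscal p (n u) e = 0" for u
    using v perp by (simp_all add: e_def pscal_expand)
  define \<phi> where "\<phi> y = pscal p y e / pscal p e e" for y
  have \<phi>: "\<phi> (t *\<^sub>R n u + u *\<^sub>R e) = u" for t u
    using e ne by (simp add: \<phi>_def pscal_expand)
  let ?g = "\<lambda>(s, t). t *\<^sub>R n s + s *\<^sub>R e" and ?J = "(\<lambda>s. \<omega> * \<sigma> s) ` I"
  have "continuous_on UNIV \<phi>"
    unfolding \<phi>_def using e by (intro continuous_intros pscal.continuous_on) auto
  then have "open (\<phi> -` ?J)" by (rule open_vimage[OF J])
  moreover have "(\<lambda>y. c *\<^sub>R y + - c *\<^sub>R w) ` ruled_map N x ` (I \<times> UNIV) = range ?g \<inter> \<phi> -` ?J"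
  proof (intro equalityI subsetI)
    fix y assume "y \<in> (\<lambda>y. c *\<^sub>R y + - c *\<^sub>R w) ` ruled_map N x ` (I \<times> UNIV)"
    then obtain s t where s: "s \<in> I" and y: "y = c *\<^sub>R (t *\<^sub>R N s + x s) - c *\<^sub>R w"
      by (auto simp: ruled_map_def)
    have "y = (c * (t + \<mu>)) *\<^sub>R N s + \<sigma> s *\<^sub>R (c *\<^sub>R v)"
      unfolding y x[OF s] by (simp add: algebra_simps)
    then have "y = ?g (\<omega> * \<sigma> s, c * (t + \<mu>))"
      unfolding cv N[OF s] by (simp add: mult.commute)
    then show "y \<in> range ?g \<inter> \<phi> -` ?J" using s \<phi> by auto
  next
    fix y assume "y \<in> range ?g \<inter> \<phi> -` ?J"
    then obtain u t where y: "y = t *\<^sub>R n u + u *\<^sub>R e" and "\<phi> y \<in> ?J" by auto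
    then have "u \<in> ?J" by (simp add: \<phi>)
    then obtain s where s: "s \<in> I" "u = \<omega> * \<sigma> s" by auto
    have "y = t *\<^sub>R N s + \<sigma> s *\<^sub>R (c *\<^sub>R v)"
      unfolding cv y s(2) N[OF s(1)] by (simp add: mult.commute)
    also have "\<dots> = c *\<^sub>R ruled_map N x (s, t / c - \<mu>) + - c *\<^sub>R w"
      using \<open>c > 0\<close> by (simp add: ruled_map_def x[OF s(1)] algebra_simps)
    finally show "y \<in> (\<lambda>y. c *\<^sub>R y + - c *\<^sub>R w) ` ruled_map N x ` (I \<times> UNIV)"
      using s(1) by blast
  qed
  ultimately show "openin (top_of_set (range ?g))
      ((\<lambda>y. c *\<^sub>R y + - c *\<^sub>R w) ` ruled_map N x ` (I \<times> UNIV))"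
    by (auto simp: openin_open)
qed

lemma pscal_normalized:
  assumes "pscal p v v \<noteq> 0"
  shows "pscal p ((1 / sqrt \<bar>pscal p v v\<bar>) *\<^sub>R v) ((1 / sqrt \<bar>pscal p v v\<bar>) *\<^sub>R v) \<in> {1, - 1}"
  using assms by (auto simp: pscal_expand abs_if field_simps split: if_splits)

lemma orthogonal_systemI:
  assumes "pscal p b b \<noteq> 0" "pscal p c c \<noteq> 0" "a \<noteq> 0"
    and "pscal p a b = 0" "pscal p a c = 0" "pscal p b c = 0"
  shows "orthogonal_system p [a, b, c]"
  using assms by (auto simp: orthogonal_system_def pscal_expand)

context constant_coefficient_ruling
begin

lemma gram_sym: "s \<in> I \<Longrightarrow> pscal p (G s) (N s) = 0" "s \<in> I \<Longrightarrow> pscal p (X s) (N s) = 0"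
  "s \<in> I \<Longrightarrow> pscal p (X s) (G s) = m"
  using gram pscal_commute by metis+

lemma open_parameter_image:
  assumes "\<omega> > 0"
  shows "open ((\<lambda>s. \<omega> * \<sigma> s) ` I)"
proof (rule strictly_increasing_open_image[OF I])
  show "((\<lambda>s. \<omega> * \<sigma> s) has_vector_derivative \<omega> * r s) (at s)" if "s \<in> I" for s
    using \<sigma>[OF that] by (rule has_vector_derivative_mult_right)
qed (use assms r in auto)

text \<open>
  For \<open>k \<noteq> 0\<close> the forcing term in \<open>x'' = - \<epsilon> m N\<close> is absorbed by \<open>(m / k) N\<close>, so that up to a slide
  along the rulings the base curve is a straight line. Its direction \<open>v\<close> satisfies
  \<open>\<langle>v, v\<rangle> = \<delta> - m\<^sup>2 / k\<close>, the extremal value of the quadratic polynomial in \<open>regular\<close>, and so is not null.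
\<close>

lemma shifted_base_curve:
  assumes "k \<noteq> 0"
  obtains v w where "\<And>s. s \<in> I \<Longrightarrow> x s = (m / k) *\<^sub>R N s + \<sigma> s *\<^sub>R v + w"
    and "pscal p v v \<noteq> 0"
    and "\<And>s. s \<in> I \<Longrightarrow> pscal p (N s) v = 0" "\<And>s. s \<in> I \<Longrightarrow> pscal p (G s) v = 0"
proof -
  have "((\<lambda>s. X s - (m / k) *\<^sub>R G s) has_vector_derivative 0) (at s)" if "s \<in> I" for s
    using X[OF that] G[OF that] assms
    by (auto intro!: derivative_eq_intros simp: algebra_simps)
  then obtain v where v: "\<And>s. s \<in> I \<Longrightarrow> X s - (m / k) *\<^sub>R G s = v"
    using zero_derivative_constant[OF I] by blast
  have "((\<lambda>s. x s - (m / k) *\<^sub>R N s - \<sigma> s *\<^sub>R v) has_vector_derivative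
      r s *\<^sub>R X s - (m / k) *\<^sub>R r s *\<^sub>R G s - r s *\<^sub>R v) (at s)" if "s \<in> I" for s
    using x[OF that] N[OF that] \<sigma>[OF that]
    by (auto intro!: derivative_eq_intros simp: has_real_derivative_iff_has_vector_derivative)
  moreover have "r s *\<^sub>R X s - (m / k) *\<^sub>R r s *\<^sub>R G s - r s *\<^sub>R v = 0" if "s \<in> I" for s
    unfolding v[OF that, symmetric] by (simp add: algebra_simps)
  ultimately have "((\<lambda>s. x s - (m / k) *\<^sub>R N s - \<sigma> s *\<^sub>R v) has_vector_derivative 0) (at s)"
    if "s \<in> I" for s using that by (metis (no_types, lifting))
  then obtain w where w: "\<And>s. s \<in> I \<Longrightarrow> x s - (m / k) *\<^sub>R N s - \<sigma> s *\<^sub>R v = w"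
    using zero_derivative_constant[OF I] by blast
  obtain s0 where s0: "s0 \<in> I" using I by (auto simp: open_interval_def)
  have "pscal p v v = (- m / k)\<^sup>2 * k + 2 * (- m / k) * m + \<delta>"
    unfolding v[OF s0, symmetric] using assms
    by (simp add: pscal_expand gram[OF s0] gram_sym[OF s0] power2_eq_square field_simps)
  then have "pscal p v v \<noteq> 0" using regular[of "- m / k"] by metis
  moreover have "pscal p (N s) v = 0" "pscal p (G s) v = 0" if "s \<in> I" for s
    unfolding v[OF that, symmetric] using assms by (simp_all add: pscal_expand gram[OF that])
  moreover have "x s = (m / k) *\<^sub>R N s + \<sigma> s *\<^sub>R v + w" if "s \<in> I" for s
    unfolding w[OF that, symmetric] by simp
  ultimately show ?thesis using that[of v w] by blast
qed

text \<open>
  A treatment common to rotations (\<open>\<kappa> = 1\<close>) and boosts (\<open>\<kappa> = -1\<close>): solving \<open>N'' = - \<kappa> \<omega>\<^sup>2 N\<close> by turning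
  the frame \<open>N, G\<close> back through the angle \<open>\<omega> \<sigma>\<close>, which gives constant vectors \<open>e1, e2\<close>.
\<close>

lemma rotating_ruling:
  fixes C S :: "real \<Rightarrow> real"
  assumes \<kappa>: "\<kappa> = 1 \<or> \<kappa> = - 1" and pos: "\<kappa> * \<epsilon> * k > 0"
    and C: "\<And>u. (C has_real_derivative - \<kappa> * S u) (at u)"
    and S: "\<And>u. (S has_real_derivative C u) (at u)"
    and CS: "\<And>u. (C u)\<^sup>2 + \<kappa> * (S u)\<^sup>2 = 1"
  obtains e1 e2 e3 where "orthonormal_system p [e1, e2, e3]"
    and "pscal p e1 e1 = \<epsilon>" "pscal p e2 e2 = \<kappa> * \<epsilon>"
    and "locally_homothetic p (ruled_map N x ` (I \<times> UNIV))
      (range (\<lambda>(s, t). t *\<^sub>R (C s *\<^sub>R e1 + S s *\<^sub>R e2) + s *\<^sub>R e3))"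
proof -
  define \<omega> where "\<omega> = sqrt (\<kappa> * \<epsilon> * k)"
  have \<omega>: "\<omega> > 0" "\<epsilon> * k = \<kappa> * \<omega>\<^sup>2" and k: "k = \<kappa> * \<epsilon> * \<omega>\<^sup>2" "k \<noteq> 0"
    using pos eps \<kappa> by (auto simp: \<omega>_def)
  obtain v w where vw: "\<And>s. s \<in> I \<Longrightarrow> x s = (m / k) *\<^sub>R N s + \<sigma> s *\<^sub>R v + w" "pscal p v v \<noteq> 0"
    "\<And>s. s \<in> I \<Longrightarrow> pscal p (N s) v = 0" "\<And>s. s \<in> I \<Longrightarrow> pscal p (G s) v = 0"
    using shifted_base_curve[OF k(2)] by blast
  let ?C = "\<lambda>s. C (\<omega> * \<sigma> s)" and ?S = "\<lambda>s. S (\<omega> * \<sigma> s)"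
  have d\<sigma>: "((\<lambda>s. \<omega> * \<sigma> s) has_real_derivative \<omega> * r s) (at s)" if "s \<in> I" for s
    unfolding has_real_derivative_iff_has_vector_derivative
    by (rule has_vector_derivative_mult_right[OF \<sigma>[OF that]])
  have dCS: "(?C has_real_derivative - \<kappa> * ?S s * (\<omega> * r s)) (at s)"
    "(?S has_real_derivative ?C s * (\<omega> * r s)) (at s)" if "s \<in> I" for s
    using DERIV_chain2[OF C d\<sigma>[OF that]] DERIV_chain2[OF S d\<sigma>[OF that]] by auto
  have "((\<lambda>s. ?C s *\<^sub>R N s - (?S s / \<omega>) *\<^sub>R G s) has_vector_derivative 0) (at s)" if s: "s \<in> I" for s
    by (rule has_vector_derivative_eq_rhs,
        rule has_vector_derivative_diff[OF has_vector_derivative_scaleR[OF dCS(1)[OF s] N[OF s]]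
          has_vector_derivative_scaleR[OF DERIV_cdivide[OF dCS(2)[OF s]] G[OF s]]])
      (use \<omega> in \<open>simp add: algebra_simps power2_eq_square\<close>)
  then obtain e1 where e1: "\<And>s. s \<in> I \<Longrightarrow> ?C s *\<^sub>R N s - (?S s / \<omega>) *\<^sub>R G s = e1"
    using zero_derivative_constant[OF I] by blast
  have "((\<lambda>s. ?S s *\<^sub>R \<kappa> *\<^sub>R N s + (?C s / \<omega>) *\<^sub>R G s) has_vector_derivative 0) (at s)" if s: "s \<in> I" for s
    by (rule has_vector_derivative_eq_rhs,
        rule has_vector_derivative_add[OF
          has_vector_derivative_scaleR[OF dCS(2)[OF s]
            bounded_linear.has_vector_derivative[OF bounded_linear_scaleR_right N[OF s]]]
          has_vector_derivative_scaleR[OF DERIV_cdivide[OF dCS(1)[OF s]] G[OF s]]])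
      (use \<omega> in \<open>simp add: algebra_simps power2_eq_square\<close>)
  then obtain e2 where e2: "\<And>s. s \<in> I \<Longrightarrow> ?S s *\<^sub>R \<kappa> *\<^sub>R N s + (?C s / \<omega>) *\<^sub>R G s = e2"
    using zero_derivative_constant[OF I] by blast
  define n where "n u = C u *\<^sub>R e1 + S u *\<^sub>R e2" for u
  have N_eq: "N s = n (\<omega> * \<sigma> s)" if "s \<in> I" for s
  proof -
    have "n (\<omega> * \<sigma> s) = ((?C s)\<^sup>2 + \<kappa> * (?S s)\<^sup>2) *\<^sub>R N s"
      unfolding n_def e1[OF that, symmetric] e2[OF that, symmetric]
      by (simp add: algebra_simps power2_eq_square)
    then show ?thesis by (simp add: CS)
  qed
  obtain s0 where s0: "s0 \<in> I" using I by (auto simp: open_interval_def)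
  have \<kappa>2: "\<kappa> * \<kappa> = 1" using \<kappa> by auto
  have "pscal p e1 e1 = \<epsilon> * ((?C s0)\<^sup>2 + \<kappa> * (?S s0)\<^sup>2)"
    unfolding e1[OF s0, symmetric] using \<omega>(1) k(1)
    by (simp add: pscal_expand gram[OF s0] gram_sym[OF s0] power2_eq_square algebra_simps)
  then have e11: "pscal p e1 e1 = \<epsilon>" by (simp add: CS)
  have "pscal p e2 e2 = \<kappa> * \<epsilon> * ((?C s0)\<^sup>2 + \<kappa> * (?S s0)\<^sup>2)"
    unfolding e2[OF s0, symmetric] using \<omega>(1) k(1)
    by (simp add: pscal_expand gram[OF s0] gram_sym[OF s0] power2_eq_square algebra_simps)
  then have e22: "pscal p e2 e2 = \<kappa> * \<epsilon>" by (simp add: CS)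
  have e12: "pscal p e1 e2 = 0"
    unfolding e1[OF s0, symmetric] e2[OF s0, symmetric] using \<omega>(1) k(1)
    by (simp add: pscal_expand gram[OF s0] gram_sym[OF s0] power2_eq_square algebra_simps)
  have ev: "pscal p e1 v = 0" "pscal p e2 v = 0"
    unfolding e1[OF s0, symmetric] e2[OF s0, symmetric] by (simp_all add: pscal_expand vw s0)
  define e3 where "e3 = (1 / sqrt \<bar>pscal p v v\<bar>) *\<^sub>R v"
  have e33: "pscal p e3 e3 \<in> {1, - 1}"
    unfolding e3_def by (rule pscal_normalized[OF vw(2)])
  have unit: "\<forall>e\<in>set [e1, e2, e3]. pscal p e e \<in> {1, - 1}"
    using e11 e22 e33 eps \<kappa> by auto
  then have "orthogonal_system p [e1, e2, e3]"
    using e12 ev by (intro orthogonal_systemI) (auto simp: e3_def pscal_expand)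
  with unit have "orthonormal_system p [e1, e2, e3]" by (simp add: orthonormal_system_def)
  moreover have "locally_homothetic p (ruled_map N x ` (I \<times> UNIV))
      (range (\<lambda>(s, t). t *\<^sub>R n s + s *\<^sub>R e3))"
    unfolding e3_def
    by (rule homothetic_to_conoid[OF open_parameter_image[OF \<omega>(1)] \<omega>(1) N_eq vw(1,2)])
      (simp_all add: n_def pscal_expand ev)
  ultimately show ?thesis using that e11 e22 unfolding n_def by blast
qed

lemma elliptic_helicoid:
  assumes "\<epsilon> * k > 0"
  shows "\<exists>M. locally_homothetic p (ruled_map N x ` (I \<times> UNIV)) M \<and> elliptic_helicoid_first p M"
proof -
  obtain e1 e2 e3 where e: "orthonormal_system p [e1, e2, e3]"
    "pscal p e1 e1 = \<epsilon>" "pscal p e2 e2 = 1 * \<epsilon>"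
    "locally_homothetic p (ruled_map N x ` (I \<times> UNIV))
      (range (\<lambda>(s, t). t *\<^sub>R (cos s *\<^sub>R e1 + sin s *\<^sub>R e2) + s *\<^sub>R e3))"
    by (rule rotating_ruling[of 1 cos sin]) (use assms in \<open>auto intro!: derivative_eq_intros\<close>)
  have "elliptic_helicoid_first p (range (\<lambda>(s, t). t *\<^sub>R (cos s *\<^sub>R e1 + sin s *\<^sub>R e2) + s *\<^sub>R e3))"
    unfolding elliptic_helicoid_first_def
    by (rule exI[of _ e1], rule exI[of _ e2], rule exI[of _ e3])
      (use e(1-3) eps in \<open>auto simp: orthonormal_system_def\<close>)
  with e(4) show ?thesis by blast
qed

lemma hyperbolic_helicoid:
  assumes "\<epsilon> * k < 0"
  shows "\<exists>M. locally_homothetic p (ruled_map N x ` (I \<times> UNIV)) M \<and> hyperbolic_helicoid_first p M"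
proof -
  obtain e1 e2 e3 where e: "orthonormal_system p [e1, e2, e3]"
    "pscal p e1 e1 = \<epsilon>" "pscal p e2 e2 = - 1 * \<epsilon>"
    "locally_homothetic p (ruled_map N x ` (I \<times> UNIV))
      (range (\<lambda>(s, t). t *\<^sub>R (cosh s *\<^sub>R e1 + sinh s *\<^sub>R e2) + s *\<^sub>R e3))"
    by (rule rotating_ruling[of "- 1" cosh sinh])
      (use assms in \<open>auto intro!: derivative_eq_intros simp: cosh_square_eq\<close>)
  have "hyperbolic_helicoid_first p (range (\<lambda>(s, t). t *\<^sub>R (cosh s *\<^sub>R e1 + sinh s *\<^sub>R e2) + s *\<^sub>R e3))"
    unfolding hyperbolic_helicoid_first_def
    by (rule exI[of _ e1], rule exI[of _ e2], rule exI[of _ e3])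
      (use e(1-3) eps in \<open>auto simp: orthonormal_system_def\<close>)
  with e(4) show ?thesis by blast
qed

text \<open>
  If \<open>k = 0\<close>, the polynomial in \<open>regular\<close> is affine without zeros, whence \<open>m = 0\<close>. So \<open>N\<close> and \<open>x\<close>
  are affine functions of \<open>\<sigma>\<close>, and the surface is a hyperbolic paraboloid, or a plane if \<open>N\<close> is constant.
\<close>

lemma planar_or_hyperbolic_paraboloid:
  assumes k: "k = 0" and non_planar: "\<not> planar (ruled_map N x ` (I \<times> UNIV))"
  shows "\<exists>M. locally_homothetic p (ruled_map N x ` (I \<times> UNIV)) M \<and> minimal_hyperbolic_paraboloid p M"
proof -
  have m: "m = 0"
  proof (rule ccontr)
    assume "m \<noteq> 0"
    then show False using regular[of "- \<delta> / (2 * m)"] k by simp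
  qed
  have \<delta>: "\<delta> \<noteq> 0" using regular[of 0] by simp
  obtain s0 where s0: "s0 \<in> I" using I by (auto simp: open_interval_def)
  obtain e1 where e1: "\<And>s. s \<in> I \<Longrightarrow> G s = e1"
    using zero_derivative_constant[OF I] G k by (metis mult_zero_left mult_zero_right neg_0_equal_iff_equal scaleR_zero_left)
  obtain v where v: "\<And>s. s \<in> I \<Longrightarrow> X s = v"
    using zero_derivative_constant[OF I] X m by (metis mult_zero_left mult_zero_right neg_0_equal_iff_equal scaleR_zero_left)
  have lin: "((\<lambda>s. c s - \<sigma> s *\<^sub>R d) has_vector_derivative 0) (at s)"
    if "s \<in> I" "(c has_vector_derivative r s *\<^sub>R d) (at s)" for c d s
    using that(2) \<sigma>[OF that(1)]
    by (auto intro!: derivative_eq_intros simp: has_real_derivative_iff_has_vector_derivative)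
  obtain e2 where e2: "\<And>s. s \<in> I \<Longrightarrow> N s - \<sigma> s *\<^sub>R e1 = e2"
    using zero_derivative_constant[OF I lin] N e1 by metis
  obtain w where w: "\<And>s. s \<in> I \<Longrightarrow> x s - \<sigma> s *\<^sub>R v = w"
    using zero_derivative_constant[OF I lin] x v by metis
  have N_eq: "N s = \<sigma> s *\<^sub>R e1 + e2" and x_eq: "x s = \<sigma> s *\<^sub>R v + w" if "s \<in> I" for s
    using e2[OF that] w[OF that] by (auto simp: algebra_simps)
  have N0: "N s0 = \<sigma> s0 *\<^sub>R e1 + e2" by (rule N_eq[OF s0])
  have e11: "pscal p e1 e1 = 0" and e1v: "pscal p e1 v = 0" and vv: "pscal p v v \<noteq> 0"
    using gram(4-6)[OF s0] \<delta> by (auto simp: e1[OF s0] v[OF s0] k m)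
  have e12: "pscal p e1 e2 = 0" and e2v: "pscal p e2 v = 0" and e22: "pscal p e2 e2 = \<epsilon>"
    using gram(1-3)[OF s0] e11 e1v pscal_commute[of p e1 e2]
    by (auto simp: N0 e1[OF s0] v[OF s0] pscal_expand)
  have "e1 \<noteq> 0"
  proof
    assume "e1 = 0"
    have "v \<noteq> e2" "v \<notin> span {e2}"
      using e2v vv by (auto simp: span_singleton pscal_expand)
    moreover have "e2 \<noteq> 0" using e22 eps by (auto simp: pscal_expand)
    ultimately have "independent {v, e2}" by (simp add: independent_insert)
    then have "dim (span {v, e2}) = 2"
      using \<open>v \<noteq> e2\<close> by (simp add: dim_eq_card_independent)
    then have "aff_dim ((+) w ` span {v, e2}) = 2"
      by (simp add: aff_dim_translation_eq aff_dim_subspace)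
    moreover have "affine ((+) w ` span {v, e2})"
      using affine_translation subspace_affine[of "span {v, e2}"] subspace_imp_affine subspace_span by blast
    moreover have "ruled_map N x ` (I \<times> UNIV) \<subseteq> (+) w ` span {v, e2}"
    proof
      fix y assume "y \<in> ruled_map N x ` (I \<times> UNIV)"
      then obtain s t where "s \<in> I" "y = t *\<^sub>R N s + x s" by (auto simp: ruled_map_def)
      then have "y = w + (\<sigma> s *\<^sub>R v + t *\<^sub>R e2)" by (simp add: N_eq x_eq \<open>e1 = 0\<close>)
      then show "y \<in> (+) w ` span {v, e2}" using mem_span_pair by blast
    qed
    ultimately show False using non_planar unfolding planar_def by blast
  qed
  define e3 where "e3 = (1 / sqrt \<bar>pscal p v v\<bar>) *\<^sub>R v"
  have e33: "pscal p e3 e3 \<in> {1, - 1}"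
    unfolding e3_def by (rule pscal_normalized[OF vv])
  have "locally_homothetic p (ruled_map N x ` (I \<times> UNIV))
      (range (\<lambda>(s, t). t *\<^sub>R (s *\<^sub>R e1 + e2) + s *\<^sub>R e3))"
    unfolding e3_def
    by (rule homothetic_to_conoid[where \<omega> = 1 and \<sigma> = \<sigma> and \<mu> = 0 and w = w])
      (use open_parameter_image[of 1] in \<open>simp_all add: N_eq x_eq vv pscal_expand e1v e2v\<close>)
  moreover have "minimal_hyperbolic_paraboloid p (range (\<lambda>(s, t). t *\<^sub>R (s *\<^sub>R e1 + e2) + s *\<^sub>R e3))"
    unfolding minimal_hyperbolic_paraboloid_def
  proof (rule exI[of _ e1], rule exI[of _ e2], rule exI[of _ e3], intro conjI)
    show "orthogonal_system p [e1, e2, e3]"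
      using e33 e22 eps e12 e1v e2v \<open>e1 \<noteq> 0\<close>
      by (intro orthogonal_systemI) (auto simp: e3_def pscal_expand)
    show "range (\<lambda>(s, t). t *\<^sub>R (s *\<^sub>R e1 + e2) + s *\<^sub>R e3) =
        range (\<lambda>(s, t). (s * t) *\<^sub>R e1 + t *\<^sub>R e2 + s *\<^sub>R e3)"
      by (simp add: scaleR_add_right mult.commute)
  qed (use e11 e22 e33 eps in auto)
  ultimately show ?thesis by blast
qed

lemma classification:
  assumes "\<not> planar (ruled_map N x ` (I \<times> UNIV))"
  shows "\<exists>M. locally_homothetic p (ruled_map N x ` (I \<times> UNIV)) M \<and>
    (elliptic_helicoid_first p M \<or> hyperbolic_helicoid_first p M \<or> minimal_hyperbolic_paraboloid p M)"
proof (cases "k = 0")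
  case True
  then show ?thesis using planar_or_hyperbolic_paraboloid assms by blast
next
  case False
  then have "\<epsilon> * k > 0 \<or> \<epsilon> * k < 0" using eps by auto
  then show ?thesis using elliptic_helicoid hyperbolic_helicoid by blast
qed

end

section \<open>Normalization of the parametrization\<close>

text \<open>
  Multiplying the direction by \<open>C exp (- \<integral> l)\<close>, where \<open>l\<close> is the logarithmic derivative of
  \<open>\<bar>\<langle>\<gamma>, \<gamma>\<rangle>\<bar>\<^sup>1\<^sup>/\<^sup>2\<close>, makes it of unit length, and a quadrature for \<open>\<tau>\<close> makes the base curve
  \<open>x + \<tau> N\<close> orthogonal to it. The minimal surface equation transforms into the one at the parameter
  \<open>T = (t + \<tau>) \<rho>\<close> of the same point of the ruling.
\<close>

lemma unit_orthogonal_parametrization: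
  fixes \<gamma> x :: "real \<Rightarrow> real ^ 'n::{finite,linorder}"
  assumes S: "ruled_surface I \<gamma> x" and H: "minimal_on p (I \<times> UNIV) (ruled_map \<gamma> x)"
    and nonnull: "\<And>s. s \<in> I \<Longrightarrow> pscal p (\<gamma> s) (\<gamma> s) \<noteq> 0"
  obtains \<epsilon> N N1 N2 y y1 y2 where "orthogonal_ruling p I \<epsilon> N N1 N2 y y1 y2"
    and "ruled_map N y ` (I \<times> UNIV) = ruled_map \<gamma> x ` (I \<times> UNIV)"
proof -
  define g1 g2 x1 x2 where "g1 = curve_deriv \<gamma>" and "g2 = curve_deriv (curve_deriv \<gamma>)"
    and "x1 = curve_deriv x" and "x2 = curve_deriv (curve_deriv x)"
  have I: "open_interval I" "open I" and smooth: "smooth_curve I \<gamma>" "smooth_curve I x"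
    using S by (auto simp: ruled_surface_def regular_curve_def open_interval_def)
  note smooth' = smooth_curve_curve_deriv[OF smooth(1)] smooth_curve_curve_deriv[OF smooth(2)]
  have g: "(\<gamma> has_vector_derivative g1 s) (at s)" and g1: "(g1 has_vector_derivative g2 s) (at s)"
    and x: "(x has_vector_derivative x1 s) (at s)" and x1: "(x1 has_vector_derivative x2 s) (at s)"
    if "s \<in> I" for s
    using that smooth smooth' unfolding g1_def g2_def x1_def x2_def
    by (blast intro: smooth_curve_derivative)+
  have cont: "continuous_on I \<gamma>" "continuous_on I g1" "continuous_on I g2"
    "continuous_on I x1" "continuous_on I x2"
    unfolding g2_def x2_def
    by (rule continuous_on_derivative, erule g g1 x1
        smooth_curve_derivative[OF smooth'(1)[THEN smooth_curve_curve_deriv]]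
        smooth_curve_derivative[OF smooth'(2)[THEN smooth_curve_curve_deriv]])+
  define q l where "q s = pscal p (\<gamma> s) (\<gamma> s)" and "l s = pscal p (\<gamma> s) (g1 s) / q s" for s
  have q0: "q s \<noteq> 0" if "s \<in> I" for s using nonnull[OF that] by (simp add: q_def)
  have gg1: "pscal p (\<gamma> s) (g1 s) = l s * q s" "pscal p (g1 s) (\<gamma> s) = l s * q s" if "s \<in> I" for s
    using q0[OF that] pscal_commute[of p "\<gamma> s"] by (simp_all add: l_def)
  define l1 where "l1 s = ((pscal p (\<gamma> s) (g2 s) + pscal p (g1 s) (g1 s)) * q s
      - pscal p (\<gamma> s) (g1 s) * (pscal p (\<gamma> s) (g1 s) + pscal p (g1 s) (\<gamma> s))) / (q s * q s)" for s
  note bil = pscal.has_vector_derivative[where p = p,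
      unfolded has_real_derivative_iff_has_vector_derivative[symmetric]]
  have l1: "(l has_real_derivative l1 s) (at s)" if s: "s \<in> I" for s
    unfolding l_def l1_def q_def
    by (rule DERIV_divide[OF bil[OF g[OF s] g1[OF s]] bil[OF g[OF s] g[OF s]]]) (rule nonnull[OF s])
  have "continuous_on I q" unfolding q_def by (intro pscal.continuous_on cont)
  then have cont_l: "continuous_on I l" "continuous_on I l1"
    unfolding l_def l1_def using q0 by (auto intro!: continuous_intros pscal.continuous_on cont)
  obtain L where L: "\<And>s. s \<in> I \<Longrightarrow> (L has_vector_derivative l s) (at s)"
    using antiderivative_on_open_interval[OF I(1) cont_l(1)] by blast
  have dexp: "((\<lambda>s. c * exp (- L s)) has_real_derivative c * exp (- L s) * - l s) (at s)"
    if "s \<in> I" for s c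
    using L[OF that] by (auto intro!: derivative_eq_intros
        simp: has_real_derivative_iff_has_vector_derivative[symmetric])
  \<comment> \<open>The squared length of \<open>exp (- L) \<gamma>\<close>; it is constant, and \<open>C\<close> normalizes it.\<close>
  define E where "E s = exp (- L s) * exp (- L s) * q s" for s
  have "(E has_vector_derivative 0) (at s)" if s: "s \<in> I" for s
  proof -
    have "(q has_real_derivative 2 * (l s * q s)) (at s)"
      using bil[OF g[OF s] g[OF s]] gg1[OF s] unfolding q_def by simp
    from DERIV_mult[OF DERIV_mult[OF dexp[OF s, of 1] dexp[OF s, of 1]] this] show ?thesis
      unfolding E_def has_real_derivative_iff_has_vector_derivative[symmetric]
      by (simp add: algebra_simps)
  qed
  then obtain e where e: "\<And>s. s \<in> I \<Longrightarrow> E s = e"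
    using zero_derivative_constant[OF I(1)] by blast
  have "e \<noteq> 0" using e q0 I(1) by (auto simp: E_def open_interval_def)
  define C where "C = 1 / sqrt \<bar>e\<bar>"
  define \<epsilon> where "\<epsilon> = e / \<bar>e\<bar>"
  have eps: "\<epsilon> = 1 \<or> \<epsilon> = - 1" using \<open>e \<noteq> 0\<close> by (auto simp: \<epsilon>_def abs_if)
  have C: "C > 0" "C * C * e = \<epsilon>" using \<open>e \<noteq> 0\<close> by (auto simp: C_def \<epsilon>_def)
  define \<rho> where "\<rho> s = C * exp (- L s)" for s
  have \<rho>0: "\<rho> s \<noteq> 0" for s using C by (simp add: \<rho>_def)
  have \<rho>: "(\<rho> has_real_derivative - (\<rho> s * l s)) (at s)" if "s \<in> I" for s
    using dexp[OF that, of C] unfolding \<rho>_def by simp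
  have \<rho>q: "\<rho> s * \<rho> s * q s = \<epsilon>" if "s \<in> I" for s
    using e[OF that] C(2) by (simp add: \<rho>_def E_def algebra_simps)
  define N N1 N2 where "N s = \<rho> s *\<^sub>R \<gamma> s" and "N1 s = \<rho> s *\<^sub>R (g1 s - l s *\<^sub>R \<gamma> s)"
    and "N2 s = \<rho> s *\<^sub>R (g2 s - (2 * l s) *\<^sub>R g1 s + (l s * l s - l1 s) *\<^sub>R \<gamma> s)" for s
  have dN: "(N has_vector_derivative N1 s) (at s)" if s: "s \<in> I" for s
    using has_vector_derivative_scaleR[OF \<rho>[OF s] g[OF s]]
    unfolding N_def N1_def by (simp add: algebra_simps)
  have dN1: "(N1 has_vector_derivative N2 s) (at s)" if s: "s \<in> I" for s
    unfolding N1_def N2_def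
    by (rule has_vector_derivative_eq_rhs[OF has_vector_derivative_scaleR[OF \<rho>[OF s]
            has_vector_derivative_diff[OF g1[OF s] has_vector_derivative_scaleR[OF l1[OF s] g[OF s]]]]])
      (simp add: vec_eq_iff algebra_simps)
  have unit: "pscal p (N s) (N s) = \<epsilon>" if "s \<in> I" for s
    using \<rho>q[OF that] by (simp add: N_def pscal_expand q_def mult.assoc)
  define h h1 where "h s = - (\<epsilon> * pscal p (N s) (x1 s))"
    and "h1 s = - (\<epsilon> * (pscal p (N s) (x2 s) + pscal p (N1 s) (x1 s)))" for s
  have h1: "(h has_real_derivative h1 s) (at s)" if s: "s \<in> I" for s
    unfolding h_def h1_def by (intro DERIV_minus DERIV_cmult bil dN x1 s)
  have cont_\<rho>: "continuous_on I \<rho>"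
    using \<rho> by (meson DERIV_isCont continuous_at_imp_continuous_on)
  have cont_N: "continuous_on I N" "continuous_on I N1" "continuous_on I N2"
    unfolding N_def N1_def N2_def by (intro continuous_intros cont_\<rho> cont_l cont)+
  have cont_h: "continuous_on I h" "continuous_on I h1"
    unfolding h_def h1_def by (intro continuous_intros pscal.continuous_on cont cont_N)+
  obtain \<tau> where \<tau>: "\<And>s. s \<in> I \<Longrightarrow> (\<tau> has_vector_derivative h s) (at s)"
    using antiderivative_on_open_interval[OF I(1) cont_h(1)] by blast
  have cont_\<tau>: "continuous_on I \<tau>" by (rule continuous_on_derivative[OF \<tau>])
  note \<tau>' = \<tau>[folded has_real_derivative_iff_has_vector_derivative]
  define y y1 y2 where "y s = x s + \<tau> s *\<^sub>R N s"
    and "y1 s = x1 s + (\<tau> s *\<^sub>R N1 s + h s *\<^sub>R N s)"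
    and "y2 s = x2 s + ((\<tau> s *\<^sub>R N2 s + h s *\<^sub>R N1 s) + (h s *\<^sub>R N1 s + h1 s *\<^sub>R N s))" for s
  have dy: "(y has_vector_derivative y1 s) (at s)" if s: "s \<in> I" for s
    unfolding y_def y1_def
    by (intro has_vector_derivative_add has_vector_derivative_scaleR x dN \<tau>' s)
  have dy1: "(y1 has_vector_derivative y2 s) (at s)" if s: "s \<in> I" for s
    unfolding y1_def y2_def
    by (intro has_vector_derivative_add has_vector_derivative_scaleR x1 dN dN1 \<tau>' h1 s)
  have cont_y2: "continuous_on I y2"
    unfolding y2_def by (intro continuous_intros cont_N cont_h cont_\<tau> cont)
  have NN1: "pscal p (N s) (N1 s) = 0" if "s \<in> I" for s
    using gg1[OF that] by (simp add: N_def N1_def pscal_expand q_def)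
  have orth: "pscal p (N s) (y1 s) = 0" if "s \<in> I" for s
    using eps by (auto simp: y1_def pscal_expand NN1[OF that] unit[OF that] h_def)
  have key: "pscal p (t *\<^sub>R N1 s + y1 s) (t *\<^sub>R N1 s + y1 s) \<noteq> 0"
    "\<exists>\<alpha> \<beta>. t *\<^sub>R N2 s + y2 s = \<alpha> *\<^sub>R (t *\<^sub>R N1 s + y1 s) + \<beta> *\<^sub>R N s" if s: "s \<in> I" for s t
  proof -
    \<comment> \<open>The coefficients that compare the first and second derivatives with respect to \<open>s\<close> of
       the two parametrizations at the same point.\<close>
    define T c d where "T = (t + \<tau> s) * \<rho> s" and "c = \<rho> s * (h s - (t + \<tau> s) * l s)"
      and "d = \<rho> s * ((t + \<tau> s) * (l s * l s - l1 s) + h1 s - 2 * h s * l s)"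
    define F where "F = T *\<^sub>R g1 s + x1 s"
    have F: "t *\<^sub>R N1 s + y1 s = F + c *\<^sub>R \<gamma> s"
      unfolding y1_def N1_def N_def F_def T_def c_def by (simp add: vec_eq_iff algebra_simps)
    have A: "t *\<^sub>R N2 s + y2 s = T *\<^sub>R g2 s + x2 s + (2 * c) *\<^sub>R g1 s + d *\<^sub>R \<gamma> s"
      unfolding y2_def N1_def N2_def N_def T_def c_def d_def by (simp add: vec_eq_iff algebra_simps)
    have "pscal p (N s) (t *\<^sub>R N1 s + y1 s) = 0"
      by (simp add: pscal_expand NN1[OF s] orth[OF s])
    then have "\<rho> s * (pscal p F (\<gamma> s) + c * q s) = 0"
      unfolding F by (simp add: N_def pscal_expand pscal_commute[of p F] q_def algebra_simps)
    then have F\<gamma>: "pscal p F (\<gamma> s) = - c * q s" using \<rho>0[of s] by simp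
    note eq = minimal_ruled_surface_equation[OF S H s, of T, folded g1_def g2_def x1_def x2_def,
        folded F_def q_def]
    have "pscal p (t *\<^sub>R N1 s + y1 s) (t *\<^sub>R N1 s + y1 s) * q s =
        pscal p F F * q s - (pscal p F (\<gamma> s))\<^sup>2"
      unfolding F using F\<gamma> pscal_commute[of p "\<gamma> s" F]
      by (simp add: pscal_expand q_def[symmetric] power2_eq_square algebra_simps)
    then show "pscal p (t *\<^sub>R N1 s + y1 s) (t *\<^sub>R N1 s + y1 s) \<noteq> 0" using eq(1) by auto
    obtain \<alpha> \<beta> where "q s *\<^sub>R (T *\<^sub>R g2 s + x2 s) - (2 * pscal p F (\<gamma> s)) *\<^sub>R g1 s = \<alpha> *\<^sub>R F + \<beta> *\<^sub>R \<gamma> s"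
      using eq(2) by blast
    then have "q s *\<^sub>R (t *\<^sub>R N2 s + y2 s) =
        \<alpha> *\<^sub>R (t *\<^sub>R N1 s + y1 s) + (\<beta> - \<alpha> * c + q s * d) *\<^sub>R \<gamma> s"
      unfolding F A F\<gamma> by (simp add: algebra_simps)
    also have "\<gamma> s = inverse (\<rho> s) *\<^sub>R N s" using \<rho>0[of s] by (simp add: N_def)
    finally have qA: "q s *\<^sub>R (t *\<^sub>R N2 s + y2 s) = \<alpha> *\<^sub>R (t *\<^sub>R N1 s + y1 s) +
        ((\<beta> - \<alpha> * c + q s * d) * inverse (\<rho> s)) *\<^sub>R N s" (is "_ = _ + ?b *\<^sub>R _") by simp
    have "t *\<^sub>R N2 s + y2 s = inverse (q s) *\<^sub>R (q s *\<^sub>R (t *\<^sub>R N2 s + y2 s))"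
      unfolding scaleR_scaleR using q0[OF s] by simp
    then have "t *\<^sub>R N2 s + y2 s =
        (inverse (q s) * \<alpha>) *\<^sub>R (t *\<^sub>R N1 s + y1 s) + (inverse (q s) * ?b) *\<^sub>R N s"
      unfolding qA by (simp only: scaleR_scaleR scaleR_add_right mult.assoc)
    then show "\<exists>\<alpha> \<beta>. t *\<^sub>R N2 s + y2 s = \<alpha> *\<^sub>R (t *\<^sub>R N1 s + y1 s) + \<beta> *\<^sub>R N s" by blast
  qed
  have "orthogonal_ruling p I \<epsilon> N N1 N2 y y1 y2"
    by unfold_locales (fact I dN dN1 dy dy1 cont_N cont_y2 unit eps orth key)+
  moreover have "ruled_map N y ` (I \<times> UNIV) = ruled_map \<gamma> x ` (I \<times> UNIV)"
    by (rule ruled_image_reparametrization[of I \<rho> N \<gamma> y x \<tau>]) (simp_all add: \<rho>0 N_def y_def)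
  ultimately show ?thesis by (rule that)
qed

section \<open>The classification\<close>

theorem theorem6:
  fixes p :: nat and I :: "real set"
    and \<gamma> x :: "real \<Rightarrow> real ^ 'n::{finite,linorder}"
  assumes "3 \<le> CARD('n)"
    and "p \<le> CARD('n) div 2"
    and "ruled_surface I \<gamma> x"
    and "minimal_on p (I \<times> UNIV) (ruled_map \<gamma> x)"
    and "generic_situations p I \<gamma> x"
    and "\<not> planar (ruled_map \<gamma> x ` (I \<times> UNIV))"
  shows "\<exists>M. locally_homothetic p (ruled_map \<gamma> x ` (I \<times> UNIV)) M \<and>
           (minimal_cylinder p M
            \<or> elliptic_helicoid_first p M
            \<or> elliptic_helicoid_second p M
            \<or> hyperbolic_helicoid_first p M
            \<or> hyperbolic_helicoid_second p M
            \<or> parabolic_helicoid p M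
            \<or> minimal_hyperbolic_paraboloid p M)"
proof -
  let ?S = "ruled_map \<gamma> x ` (I \<times> UNIV)"
  have I: "open_interval I" and \<gamma>: "smooth_curve I \<gamma>"
    using assms(3) by (auto simp: ruled_surface_def)
  have "(\<forall>s\<in>I. pscal p (\<gamma> s) (\<gamma> s) = 0) \<or> (\<forall>s\<in>I. pscal p (\<gamma> s) (\<gamma> s) \<noteq> 0)"
  proof (rule nonsingular_zero_dichotomy[OF I])
    have "continuous_on I \<gamma>" using \<gamma> smooth_curve_derivative continuous_on_derivative by blast
    then show "continuous_on I (\<lambda>s. pscal p (\<gamma> s) (\<gamma> s))" by (intro pscal.continuous_on)
    show "\<not> (pscal p (\<gamma> s) (\<gamma> s) = 0 \<and> frequently (\<lambda>s. pscal p (\<gamma> s) (\<gamma> s) \<noteq> 0) (nhds s))"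
      if "s \<in> I" for s
      using assms(5) that by (simp add: generic_situations_def singular_at_def)
  qed
  then consider (null) "\<And>s. s \<in> I \<Longrightarrow> pscal p (\<gamma> s) (\<gamma> s) = 0"
    | (nonnull) "\<And>s. s \<in> I \<Longrightarrow> pscal p (\<gamma> s) (\<gamma> s) \<noteq> 0" by blast
  then show ?thesis
  proof cases
    case null
    then have "minimal_cylinder p ?S"
      by (rule null_ruling_minimal_cylinder[OF assms(3,4)])
    moreover have "locally_homothetic p ?S ?S"
      by (rule locally_homotheticI[of 1 _ 0]) simp_all
    ultimately show ?thesis by blast
  next
    case nonnull
    obtain \<epsilon> N N1 N2 y y1 y2 where ruling: "orthogonal_ruling p I \<epsilon> N N1 N2 y y1 y2"
      and image: "ruled_map N y ` (I \<times> UNIV) = ?S"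
      using unit_orthogonal_parametrization[OF assms(3,4) nonnull] by blast
    obtain k m \<delta> G X \<sigma> r where "constant_coefficient_ruling p I \<epsilon> k m \<delta> N G y X \<sigma> r"
      using orthogonal_ruling.constant_coefficients[OF ruling] by blast
    from constant_coefficient_ruling.classification[OF this] show ?thesis
      unfolding image using assms(6) by blast
  qed
qed

end
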